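(* With probability one there exists $n_0$ such that for every $n\ge n_0$ the function $\mathbb R^4\ni(\alpha',\mu'_\varepsilon,\theta_1',\theta_2')\mapsto Q_n(\mathbf Y_n;\alpha',\mu'_\varepsilon,\theta_1',\theta_2')$ has a unique global minimizer, denoted $(\hat\alpha_n,\hat\mu_{\varepsilon,n},\hat\theta_{1,n},\hat\theta_{2,n})$. Moreover, for every $(\alpha,\mu_\varepsilon,\theta_1,\theta_2)\in(0,1)\times(0,\infty)\times\mathbb N^2$, almost surely $\hat\alpha_n\to\alpha$, $\hat\mu_{\varepsilon,n}\to\mu_\varepsilon$ and $$\begin{bmatrix}\hat\theta_{1,n}\\ \hat\theta_{2,n}\end{bmatrix}\to\begin{bmatrix}Y_s\\ Y_{s+1}\end{bmatrix}+\frac{1}{1+\alpha^2+\alpha^4}\begin{bmatrix}-\alpha(1+\alpha^2)Y_{s-1}-\alpha^2Y_{s+2}-(1-\alpha^3)\mu_\varepsilon\\ -\alpha^2Y_{s-1}-\alpha(1+\alpha^2)Y_{s+2}-(1-\alpha^3)\mu_\varepsilon\end{bmatrix}.$$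
   Context: INAR(1) process: Let $\alpha\in(0,1)$. Let $(\varepsilon_k)_{k\in\mathbb N}$ be i.i.d. non-negative integer-valued random variables with $\mathbb E\varepsilon_1^2<\infty$ and $\mathbb P(\varepsilon_1\ne 0)>0$; write $\mu_\varepsilon=\mathbb E\varepsilon_1$. For each $k\in\mathbb N$ let $(\xi_{k,j})_{j\in\mathbb N}$ be i.i.d. Bernoulli random variables with mean $\alpha$, these sequences being mutually independent and independent of $(\varepsilon_k)$. Let $X_0$ be a non-negative integer-valued random variable with $\mathbb E X_0^2<\infty$, independent of all $\xi_{k,j}$ and $\varepsilon_k$, and set $X_k=\sum_{j=1}^{X_{k-1}}\xi_{k,j}+\varepsilon_k$ for $k\in\mathbb N$. Two neighbouring additive outliers: fix known $s\in\mathbb N$ and $\theta_1,\theta_2\in\mathbb N$; $Y_k=X_k+\delta_{k,s}\theta_1+\delta_{k,s+1}\theta_2$, $k\in\mathbb Z_+$; $\mathbf Y_n=(Y_0,\dots,Y_n)$. For $n\ge\max(3,s+2)$, $$Q_n(\mathbf y_n;\alpha',\mu'_\varepsilon,\theta_1',\theta_2')=\sum_{\substack{k=1\\k\notin\{s,s+1,s+2\}}}^n(y_k-\alpha'y_{k-1}-\mu'_\varepsilon)^2+(y_s-\alpha'y_{s-1}-\mu'_\varepsilon-\theta_1')^2+(y_{s+1}-\alpha'y_s-\mu'_\varepsilon+\alpha'\theta_1'-\theta_2')^2+(y_{s+2}-\alpha'y_{s+1}-\mu'_\varepsilon+\alpha'\theta_2')^2 .$$ *)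

theory Defs
  imports "HOL-Probability.Probability"
begin

text \<open>Indices of the primitive random variables of the INAR(1) model:
  the initial value X_0, the innovations eps_k (k >= 1) and the
  Bernoulli counting variables xi_{k,j} (k, j >= 1).\<close>
datatype inar_idx = InitIdx | EpsIdx nat | XiIdx nat nat

definition inar_index_set :: "inar_idx set" where
  "inar_index_set = {InitIdx} \<union> {EpsIdx k | k. k \<ge> 1} \<union> {XiIdx k j | k j. k \<ge> 1 \<and> j \<ge> 1}"

definition inar_vars ::
  "('a \<Rightarrow> nat) \<Rightarrow> (nat \<Rightarrow> 'a \<Rightarrow> nat) \<Rightarrow> (nat \<Rightarrow> nat \<Rightarrow> 'a \<Rightarrow> nat) \<Rightarrow> inar_idx \<Rightarrow> 'a \<Rightarrow> nat" where
  "inar_vars X0 eps xi i = (case i of InitIdx \<Rightarrow> X0 | EpsIdx k \<Rightarrow> eps k | XiIdx k j \<Rightarrow> xi k j)"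

primrec inar_X ::
  "('a \<Rightarrow> nat) \<Rightarrow> (nat \<Rightarrow> 'a \<Rightarrow> nat) \<Rightarrow> (nat \<Rightarrow> nat \<Rightarrow> 'a \<Rightarrow> nat) \<Rightarrow> nat \<Rightarrow> 'a \<Rightarrow> nat" where
  "inar_X X0 eps xi 0 \<omega> = X0 \<omega>"
| "inar_X X0 eps xi (Suc k) \<omega> =
     (\<Sum>j\<in>{1..inar_X X0 eps xi k \<omega>}. xi (Suc k) j \<omega>) + eps (Suc k) \<omega>"

text \<open>Observed process with two neighbouring additive outliers at times s and s+1.\<close>
definition inar_Y ::
  "('a \<Rightarrow> nat) \<Rightarrow> (nat \<Rightarrow> 'a \<Rightarrow> nat) \<Rightarrow> (nat \<Rightarrow> nat \<Rightarrow> 'a \<Rightarrow> nat) \<Rightarrow> nat \<Rightarrow> nat \<Rightarrow> nat \<Rightarrow> nat \<Rightarrow> 'a \<Rightarrow> real" where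
  "inar_Y X0 eps xi s \<theta>1 \<theta>2 k \<omega> =
     real (inar_X X0 eps xi k \<omega>) + (if k = s then real \<theta>1 else 0) + (if k = s + 1 then real \<theta>2 else 0)"

definition Q2 :: "nat \<Rightarrow> nat \<Rightarrow> (nat \<Rightarrow> real) \<Rightarrow> real \<times> real \<times> real \<times> real \<Rightarrow> real" where
  "Q2 s n y p = (case p of (a, m, t1, t2) \<Rightarrow>
      (\<Sum>k\<in>{1..n} - {s, s+1, s+2}. (y k - a * y (k - 1) - m)\<^sup>2)
      + (y s - a * y (s - 1) - m - t1)\<^sup>2
      + (y (s+1) - a * y s - m + a * t1 - t2)\<^sup>2
      + (y (s+2) - a * y (s+1) - m + a * t2)\<^sup>2)"

definition Q2_argmin :: "nat \<Rightarrow> nat \<Rightarrow> (nat \<Rightarrow> real) \<Rightarrow> real \<times> real \<times> real \<times> real" where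
  "Q2_argmin s n y = (THE p. \<forall>q. Q2 s n y p \<le> Q2 s n y q)"

end

theory Submission
  imports Defs "HOL-Real_Asymp.Real_Asymp"
begin

text \<open>
  Minimizing over the two outlier sizes first, the three affected residuals
  $A = y_s - a y_{s-1} - m - t_1$, $B = y_{s+1} - a y_s - m + a t_1 - t_2$ and
  $C = y_{s+2} - a y_{s+1} - m + a t_2$ satisfy that $a^2 A + a B + C$ does not depend on
  $(t_1, t_2)$, so they contribute at least $(a^2 A + a B + C)^2 / (1 + a^2 + a^4)$, with equality
  for exactly one pair $(t_1, t_2)$. What remains in $(a, m)$ is the ordinary least squares functional
  of the uncontaminated chain plus a fixed nonnegative smooth term. The former grows like
  $n |(a, m) - (\alpha, \mu)|^2$, which for large $n$ confines the minimizers to small balls around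
  $(\alpha, \mu)$ and dominates the second differences of the fixed term there.

  Under second moments only, the noise averages are controlled by truncating the chain at
  $k^{3/4}$: the truncated terms are orthogonal with variances $O(k^{3/4})$, so the
  Rademacher-Menshov maximal inequality gives their strong law, and the truncation is eventually
  inactive because $\sum_k k^{-3/2} X_k^2$ has finite expectation. The sample variance stays away from zero
  because the integer valued chain either cannot sit at its mean, or leaves it with positive frequency.
\<close>

text \<open>The weighted error average is where second moments hurt. The error of a step has
  variance linear in the current state; multiplied by the state, its variance is cubic, and third
  moments may be infinite. Cutting the state at b_k = k^c bounds that variance by a constant times
  b_k E X_k^2. The exponent is squeezed from two sides: the cut becomes void once the sum of k^(-2c)
  converges, so c > 1/2, while the dyadic maximal inequality tolerates variances k^c with c < 1, its
  logarithmic loss being harmless. The choice 3/4 is the midpoint.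

  The cut is made on the state and not on the noise, so the truncated terms stay exactly centered
  given the past, and no compensator has to be estimated.

  The term left over after profiling is a rational function that need not be convex, so uniqueness
  must come from the sample size. There the quadratic form only has to dominate: a positive lower
  bound for the sample variance takes the place of its limit, and no stationary version of the chain
  enters.\<close>

section \<open>A strong law for orthogonal sequences\<close>

text \<open>The sum of the squared block sums over all dyadic subblocks of the interval from $a$ to $a + 2^r$:
  the majorant in the Rademacher-Menshov maximal inequality.\<close>
primrec dyadic_energy :: "(nat \<Rightarrow> real) \<Rightarrow> nat \<Rightarrow> nat \<Rightarrow> real" where
  "dyadic_energy t 0 a = (t a)\<^sup>2"
| "dyadic_energy t (Suc r) a =
     dyadic_energy t r a + dyadic_energy t r (a + 2 ^ r) + (\<Sum>k\<in>{a..<a + 2 ^ Suc r}. t k)\<^sup>2"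

lemma dyadic_energy_nonneg: "0 \<le> dyadic_energy t r a"
  by (induction r arbitrary: a) auto

lemma block_le_dyadic_energy: "(\<Sum>k\<in>{a..<a + 2 ^ r}. t k)\<^sup>2 \<le> dyadic_energy t r a"
  by (cases r) (simp_all add: dyadic_energy_nonneg)

text \<open>The binary digits of \<open>n\<close> cut the partial sum into at most one dyadic block
  per level, and Cauchy-Schwarz over the levels costs the factor r + 1. The right-hand side does not
  depend on \<open>n\<close>, so it bounds the maximum over all partial sums.\<close>

lemma partial_block_le_dyadic_energy:
  "n \<le> 2 ^ r \<Longrightarrow> (\<Sum>k\<in>{a..<a + n}. t k)\<^sup>2 \<le> (real r + 1) * dyadic_energy t r a"
proof (induction r arbitrary: a n)
  case 0
  then have "n = 0 \<or> n = 1" by auto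
  then show ?case by auto
next
  case (Suc r)
  let ?G = "dyadic_energy t"
  have mono: "(real r + 1) * ?G r a \<le> (real (Suc r) + 1) * ?G (Suc r) a"
    by (intro mult_mono) (auto simp: dyadic_energy_nonneg)
  show ?case
  proof (cases "n \<le> 2 ^ r")
    case True
    then show ?thesis using Suc.IH[of n a] mono by linarith
  next
    case False
    define x where "x = (\<Sum>k\<in>{a..<a + 2 ^ r}. t k)"
    define y where "y = (\<Sum>k\<in>{a + 2 ^ r..<(a + 2 ^ r) + (n - 2 ^ r)}. t k)"
    have split: "(\<Sum>k\<in>{a..<a + n}. t k) = x + y"
      unfolding x_def y_def using False by (subst sum.atLeastLessThan_concat) auto
    have "y\<^sup>2 \<le> (real r + 1) * ?G r (a + 2 ^ r)"
      unfolding y_def using Suc.prems False by (intro Suc.IH) auto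
    moreover have "x\<^sup>2 \<le> ?G r a"
      unfolding x_def by (rule block_le_dyadic_energy)
    \<comment> \<open>Cauchy-Schwarz with weights 1 and r + 1: the already weighted tail
      \<open>y\<close> is divided by its own factor, so the constant grows by exactly one per
      level.\<close>
    moreover have "(x + y)\<^sup>2 \<le> (real r + 2) * (x\<^sup>2 + y\<^sup>2 / (real r + 1))"
    proof -
      have "0 \<le> ((real r + 1) * x - y)\<^sup>2" by simp
      then have "(real r + 1) * (x + y)\<^sup>2 \<le> (real r + 2) * ((real r + 1) * x\<^sup>2 + y\<^sup>2)"
        by (simp add: power2_eq_square algebra_simps)
      then show ?thesis by (simp add: field_simps)
    qed
    moreover have "(real r + 2) * (x\<^sup>2 + y\<^sup>2 / (real r + 1)) \<le> (real r + 2) * ?G (Suc r) a"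
    proof (rule mult_left_mono)
      have "y\<^sup>2 / (real r + 1) \<le> ?G r (a + 2 ^ r)"
        using calculation(1) by (simp add: divide_le_eq mult.commute)
      with \<open>x\<^sup>2 \<le> ?G r a\<close> show "x\<^sup>2 + y\<^sup>2 / (real r + 1) \<le> ?G (Suc r) a"
        by (simp add: add_increasing2 add_mono)
    qed simp
    ultimately have "(\<Sum>k\<in>{a..<a + n}. t k)\<^sup>2 \<le> (real r + 2) * ?G (Suc r) a"
      unfolding split by (meson order_trans)
    then show ?thesis by (simp del: dyadic_energy.simps add: add_ac)
  qed
qed

text \<open>A rational base in place of 2^(3/4), valid because 1.7^4 = 8.3521 is at least 8. What
  matters later is that 2 * 1.7 / 4 = 0.85 lies below 1.\<close>

lemma power2_powr_three_quarters_le: "((2::real) ^ n) powr (3/4) \<le> (17/10) ^ n"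
proof -
  have "((2::real) powr (3/4)) ^ 4 = 2 powr 3"
    by (simp add: powr_power)
  also have "\<dots> \<le> (17/10) ^ 4" by (simp add: power_divide)
  finally have "(2::real) powr (3/4) \<le> 17/10"
    by (subst (asm) power_mono_iff) auto
  then have "((2::real) powr (3/4)) ^ n \<le> (17/10) ^ n" by (rule power_mono) simp
  moreover have "((2::real) ^ n) powr (3/4) = (2 powr (3/4)) ^ n"
    by (simp add: powr_realpow[symmetric] powr_powr powr_power mult.commute)
  ultimately show ?thesis by simp
qed

section \<open>Almost sure convergence from second moments\<close>

context prob_space
begin

text \<open>By monotone convergence the sum of the \<open>f n\<close> has finite expectation, hence
  is almost surely finite, and the terms of a convergent series vanish. This does the work of
  Chebyshev plus Borel-Cantelli.\<close>

lemma AE_tendsto_zero_of_summable_expectation: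
  fixes f :: "nat \<Rightarrow> 'a \<Rightarrow> real"
  assumes int: "\<And>n. integrable M (f n)" and nn: "\<And>n \<omega>. 0 \<le> f n \<omega>"
    and sm: "summable (\<lambda>n. expectation (f n))"
  shows "AE \<omega> in M. (\<lambda>n. f n \<omega>) \<longlonglongrightarrow> 0"
proof -
  have [measurable]: "f n \<in> borel_measurable M" for n using int by auto
  have "(\<integral>\<^sup>+\<omega>. (\<Sum>n. ennreal (f n \<omega>)) \<partial>M) = (\<Sum>n. \<integral>\<^sup>+\<omega>. ennreal (f n \<omega>) \<partial>M)"
    by (rule nn_integral_suminf) simp
  also have "\<dots> = (\<Sum>n. ennreal (expectation (f n)))"
    using int nn by (simp add: nn_integral_eq_integral)
  also have "\<dots> = ennreal (\<Sum>n. expectation (f n))"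
    by (intro suminf_ennreal2 sm integral_nonneg_AE) (auto simp: nn)
  finally have "(\<integral>\<^sup>+\<omega>. (\<Sum>n. ennreal (f n \<omega>)) \<partial>M) \<noteq> \<infinity>" by simp
  then have "AE \<omega> in M. (\<Sum>n. ennreal (f n \<omega>)) \<noteq> \<infinity>"
    by (intro nn_integral_noteq_infinite) auto
  then show ?thesis
  proof eventually_elim
    case (elim \<omega>)
    then have "summable (\<lambda>n. f n \<omega>)"
      using nn by (intro summable_suminf_not_top) auto
    then show ?case by (rule summable_LIMSEQ_zero)
  qed
qed

lemma integrable_mult_of_squares:
  fixes f g :: "'a \<Rightarrow> real"
  assumes [measurable]: "f \<in> borel_measurable M" "g \<in> borel_measurable M"
    and "integrable M (\<lambda>\<omega>. (f \<omega>)\<^sup>2)" "integrable M (\<lambda>\<omega>. (g \<omega>)\<^sup>2)"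
  shows "integrable M (\<lambda>\<omega>. f \<omega> * g \<omega>)"
proof (rule Bochner_Integration.integrable_bound)
  show "integrable M (\<lambda>\<omega>. (f \<omega>)\<^sup>2 + (g \<omega>)\<^sup>2)" using assms by simp
  show "AE \<omega> in M. norm (f \<omega> * g \<omega>) \<le> norm ((f \<omega>)\<^sup>2 + (g \<omega>)\<^sup>2)"
  proof (intro AE_I2)
    fix \<omega>
    have "0 \<le> (\<bar>f \<omega>\<bar> - \<bar>g \<omega>\<bar>)\<^sup>2" by simp
    then have "2 * (\<bar>f \<omega>\<bar> * \<bar>g \<omega>\<bar>) \<le> (f \<omega>)\<^sup>2 + (g \<omega>)\<^sup>2"
      by (simp add: power2_eq_square algebra_simps)
    moreover have "0 \<le> \<bar>f \<omega>\<bar> * \<bar>g \<omega>\<bar>" by simp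
    ultimately have "\<bar>f \<omega>\<bar> * \<bar>g \<omega>\<bar> \<le> (f \<omega>)\<^sup>2 + (g \<omega>)\<^sup>2" by linarith
    then show "norm (f \<omega> * g \<omega>) \<le> norm ((f \<omega>)\<^sup>2 + (g \<omega>)\<^sup>2)"
      by (simp add: abs_mult)
  qed
qed simp

lemma integrable_of_square:
  fixes f :: "'a \<Rightarrow> real"
  assumes "f \<in> borel_measurable M" "integrable M (\<lambda>\<omega>. (f \<omega>)\<^sup>2)"
  shows "integrable M f"
  using integrable_mult_of_squares[of f "\<lambda>_. 1"] assms by simp

lemma integrable_event: "A \<in> events \<Longrightarrow> integrable M (indicator A :: 'a \<Rightarrow> real)"
  by (rule integrable_real_indicator) (auto simp: emeasure_eq_measure)

context
  fixes T :: "nat \<Rightarrow> 'a \<Rightarrow> real"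
  assumes meas: "\<And>k. T k \<in> borel_measurable M"
    and sq: "\<And>k. integrable M (\<lambda>\<omega>. (T k \<omega>)\<^sup>2)"
    and orth: "\<And>i k. i < k \<Longrightarrow> expectation (\<lambda>\<omega>. T i \<omega> * T k \<omega>) = 0"
begin

lemma orthogonal_sum_square:
  assumes "finite A"
  shows "integrable M (\<lambda>\<omega>. (\<Sum>k\<in>A. T k \<omega>)\<^sup>2)"
    and "expectation (\<lambda>\<omega>. (\<Sum>k\<in>A. T k \<omega>)\<^sup>2) = (\<Sum>k\<in>A. expectation (\<lambda>\<omega>. (T k \<omega>)\<^sup>2))"
proof -
  have int: "integrable M (\<lambda>\<omega>. T i \<omega> * T k \<omega>)" for i k
    by (intro integrable_mult_of_squares meas sq)
  have orth': "expectation (\<lambda>\<omega>. T i \<omega> * T k \<omega>) = 0" if "i \<noteq> k" for i k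
    using orth[of i k] orth[of k i] that by (cases "i < k") (auto simp: mult.commute)
  have eq: "(\<Sum>k\<in>A. T k \<omega>)\<^sup>2 = (\<Sum>i\<in>A. \<Sum>k\<in>A. T i \<omega> * T k \<omega>)" for \<omega>
    by (simp add: power2_eq_square sum_product)
  show "integrable M (\<lambda>\<omega>. (\<Sum>k\<in>A. T k \<omega>)\<^sup>2)"
    unfolding eq using int by simp
  have "expectation (\<lambda>\<omega>. (\<Sum>k\<in>A. T k \<omega>)\<^sup>2) = (\<Sum>i\<in>A. \<Sum>k\<in>A. expectation (\<lambda>\<omega>. T i \<omega> * T k \<omega>))"
    unfolding eq using int by simp
  also have "\<dots> = (\<Sum>i\<in>A. \<Sum>k\<in>A. if k = i then expectation (\<lambda>\<omega>. (T i \<omega>)\<^sup>2) else 0)"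
    using orth' by (intro sum.cong refl) (auto simp: power2_eq_square)
  also have "\<dots> = (\<Sum>k\<in>A. expectation (\<lambda>\<omega>. (T k \<omega>)\<^sup>2))"
    using assms by (simp add: sum.delta)
  finally show "expectation (\<lambda>\<omega>. (\<Sum>k\<in>A. T k \<omega>)\<^sup>2) = (\<Sum>k\<in>A. expectation (\<lambda>\<omega>. (T k \<omega>)\<^sup>2))" .
qed

text \<open>The blocks of one level partition the interval, so by orthogonality each level
  contributes the full sum of variances, and there are r + 1 levels.\<close>

lemma expectation_dyadic_energy:
  "integrable M (\<lambda>\<omega>. dyadic_energy (\<lambda>k. T k \<omega>) r a) \<and>
   expectation (\<lambda>\<omega>. dyadic_energy (\<lambda>k. T k \<omega>) r a) =
     (real r + 1) * (\<Sum>k\<in>{a..<a + 2 ^ r}. expectation (\<lambda>\<omega>. (T k \<omega>)\<^sup>2))"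
proof (induction r arbitrary: a)
  case 0
  then show ?case using sq by simp
next
  case (Suc r)
  have "(\<Sum>k\<in>{a..<a + 2 ^ Suc r}. g k) =
      (\<Sum>k\<in>{a..<a + 2 ^ r}. g k) + (\<Sum>k\<in>{a + 2 ^ r..<a + 2 ^ r + 2 ^ r}. g k)" for g :: "nat \<Rightarrow> real"
    by (subst sum.atLeastLessThan_concat) (auto simp: mult_2 add.assoc)
  then show ?case
    using Suc.IH[of a] Suc.IH[of "a + 2 ^ r"] orthogonal_sum_square[of "{a..<a + 2 ^ Suc r}"]
    by (simp del: power_Suc add: algebra_simps)
qed

text \<open>One majorant serves all n from 2^r up to 2^(r+1): the squared average of the first n
  terms is at most \<open>f r\<close>, whose expectation is of order r^2 (17/20)^r and therefore
  summable.\<close>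

theorem orthogonal_strong_law:
  assumes bound: "\<And>k. expectation (\<lambda>\<omega>. (T k \<omega>)\<^sup>2) \<le> C * (1 + real k) powr (3/4)"
  shows "AE \<omega> in M. (\<lambda>n. (\<Sum>k<n. T k \<omega>) / real n) \<longlonglongrightarrow> 0"
proof -
  \<comment> \<open>The factor r + 2 is the Cauchy-Schwarz constant for blocks of length 2^(r+1);
    the expected energy supplies a second such factor. Dividing by 4^r prepares for n^2, since n is
    at least 2^r.\<close>
  define f where "f r \<omega> = (real r + 2) * dyadic_energy (\<lambda>k. T k \<omega>) (Suc r) 0 / 4 ^ r" for r \<omega>
  have int: "integrable M (f r)" for r
    unfolding f_def using expectation_dyadic_energy by (simp del: dyadic_energy.simps)
  have nn: "0 \<le> f r \<omega>" for r \<omega>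
    unfolding f_def by (simp del: dyadic_energy.simps add: dyadic_energy_nonneg)
  have "0 \<le> expectation (\<lambda>\<omega>. (T 0 \<omega>)\<^sup>2)" by simp
  then have C: "0 \<le> C" using order_trans[OF _ bound[of 0]] by simp
  have Ef: "expectation (f r) \<le> C * ((real r + 2)\<^sup>2 * (2 ^ Suc r * (17/10) ^ Suc r) / 4 ^ r)" for r
  proof -
    have "(\<Sum>k\<in>{0..<0 + 2 ^ Suc r}. expectation (\<lambda>\<omega>. (T k \<omega>)\<^sup>2))
        \<le> (\<Sum>k\<in>{0..<0 + (2::nat) ^ Suc r}. C * (17/10) ^ Suc r)"
    proof (rule sum_mono)
      fix k :: nat assume "k \<in> {0..<0 + 2 ^ Suc r}"
      then have "Suc k \<le> 2 ^ Suc r" by simp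
      then have "real (Suc k) \<le> real (2 ^ Suc r)" by (simp only: of_nat_le_iff)
      then have "(1 + real k) powr (3/4) \<le> (2 ^ Suc r) powr (3/4)"
        by (intro powr_mono2) auto
      also have "\<dots> \<le> (17/10) ^ Suc r" by (rule power2_powr_three_quarters_le)
      finally have "(1 + real k) powr (3/4) \<le> (17/10) ^ Suc r" .
      then have "C * (1 + real k) powr (3/4) \<le> C * (17/10) ^ Suc r"
        using C by (rule mult_left_mono)
      then show "expectation (\<lambda>\<omega>. (T k \<omega>)\<^sup>2) \<le> C * (17/10) ^ Suc r"
        using bound[of k] by linarith
    qed
    also have "\<dots> = C * (2 ^ Suc r * (17/10) ^ Suc r)" by simp
    finally have *: "(\<Sum>k\<in>{0..<0 + 2 ^ Suc r}. expectation (\<lambda>\<omega>. (T k \<omega>)\<^sup>2))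
        \<le> C * (2 ^ Suc r * (17/10) ^ Suc r)" .
    have "expectation (f r) = (real r + 2)\<^sup>2 / 4 ^ r * (\<Sum>k\<in>{0..<0 + 2 ^ Suc r}. expectation (\<lambda>\<omega>. (T k \<omega>)\<^sup>2))"
      unfolding f_def using expectation_dyadic_energy[of "Suc r" 0]
      by (simp del: dyadic_energy.simps power_Suc add: power2_eq_square)
    also have "\<dots> \<le> (real r + 2)\<^sup>2 / 4 ^ r * (C * (2 ^ Suc r * (17/10) ^ Suc r))"
      by (rule mult_left_mono[OF *]) simp
    finally show ?thesis by (simp add: mult_ac)
  qed
  have "summable (\<lambda>r. C * ((real r + 2)\<^sup>2 * (2 ^ Suc r * (17/10) ^ Suc r) / 4 ^ r))"
  proof (rule summable_mult, rule summable_comparison_test_bigo)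
    \<comment> \<open>Any ratio strictly between 17/20 and 1 absorbs the polynomial factor.\<close>
    show "summable (\<lambda>r. norm ((9/10 :: real) ^ r))" by (simp add: summable_geometric)
    show "(\<lambda>r. (real r + 2)\<^sup>2 * (2 ^ Suc r * (17/10) ^ Suc r) / 4 ^ r) \<in> O(\<lambda>r. (9/10) ^ r)"
    proof -
      have "(2 ^ Suc r * (17/10) ^ Suc r) / 4 ^ r = (17/5) * (17/20 :: real) ^ r" for r
        by (induction r) (auto simp: field_simps)
      then have "(real r + 2)\<^sup>2 * (2 ^ Suc r * (17/10) ^ Suc r) / 4 ^ r = (real r + 2)\<^sup>2 * ((17/5) * (17/20) ^ r)" for r
        by (metis times_divide_eq_right)
      moreover have "(\<lambda>r. (real r + 2)\<^sup>2 * ((17/5) * (17/20) ^ r)) \<in> O(\<lambda>r. (9/10) ^ r)"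
        by real_asymp
      ultimately show ?thesis by (simp only:)
    qed
  qed
  then have "summable (\<lambda>r. expectation (f r))"
  proof (rule summable_comparison_test_ev[rotated], intro always_eventually allI)
    fix r
    have "0 \<le> expectation (f r)" by (simp add: integral_nonneg_AE nn)
    then show "norm (expectation (f r)) \<le> C * ((real r + 2)\<^sup>2 * (2 ^ Suc r * (17/10) ^ Suc r) / 4 ^ r)"
      using Ef[of r] by (simp only: real_norm_def abs_of_nonneg)
  qed
  then have "AE \<omega> in M. (\<lambda>r. f r \<omega>) \<longlonglongrightarrow> 0"
    by (intro AE_tendsto_zero_of_summable_expectation int nn)
  then show ?thesis
  proof eventually_elim
    case (elim \<omega>)
    show ?case
    proof (rule LIMSEQ_I)
      fix e :: real assume e: "0 < e"
      then obtain R where R: "\<And>r. r \<ge> R \<Longrightarrow> f r \<omega> < e\<^sup>2"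
        using LIMSEQ_D[OF elim, of "e\<^sup>2"] nn by (auto simp: abs_of_nonneg)
      show "\<exists>N. \<forall>n\<ge>N. norm ((\<Sum>k<n. T k \<omega>) / real n - 0) < e"
      proof (intro exI allI impI)
        fix n :: nat assume n: "n \<ge> 2 ^ R"
        then have "n \<ge> 1" by (meson one_le_numeral one_le_power order_trans)
        then obtain r where r: "2 ^ r \<le> n" "n < 2 ^ Suc r"
          using ex_power_ivl1[of 2 n] by auto
        have "R \<le> r"
        proof (rule ccontr)
          assume "\<not> R \<le> r"
          then have "(2::nat) ^ Suc r \<le> 2 ^ R" by (intro power_increasing) auto
          with n r show False by linarith
        qed
        have "(\<Sum>k<n. T k \<omega>)\<^sup>2 \<le> (real r + 2) * dyadic_energy (\<lambda>k. T k \<omega>) (Suc r) 0"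
          using partial_block_le_dyadic_energy[of n "Suc r" "\<lambda>k. T k \<omega>" 0] r
          by (simp del: dyadic_energy.simps power_Suc add: lessThan_atLeast0 add_ac)
        also have "\<dots> = f r \<omega> * (2 ^ r)\<^sup>2"
          unfolding f_def by (simp del: dyadic_energy.simps add: power_mult[symmetric] power_mult_distrib mult.commute[of r] power_mult)
        also have "\<dots> \<le> f r \<omega> * (real n)\<^sup>2"
        proof -
          have "real (2 ^ r) \<le> real n" using r by (simp only: of_nat_le_iff)
          then show ?thesis by (intro mult_left_mono power_mono nn) auto
        qed
        also have "\<dots> < e\<^sup>2 * (real n)\<^sup>2"
          using R[OF \<open>R \<le> r\<close>] \<open>n \<ge> 1\<close> by (intro mult_strict_right_mono) auto
        finally have "(\<Sum>k<n. T k \<omega>)\<^sup>2 < (e * real n)\<^sup>2" by (simp add: power_mult_distrib)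
        moreover have "0 \<le> e * real n" using e by simp
        ultimately have "\<bar>\<Sum>k<n. T k \<omega>\<bar> < e * real n"
          by (metis power2_abs power2_less_imp_less)
        then show "norm ((\<Sum>k<n. T k \<omega>) / real n - 0) < e"
          using \<open>n \<ge> 1\<close> by (simp add: divide_less_eq)
      qed
    qed
  qed
qed

end

end

section \<open>Minimizers of asymptotically quadratic functions\<close>

text \<open>A derivative-free substitute for bounded second derivatives. Only the last clause is used for
  convexity; the other two make the class closed under products and inverses.\<close>
definition midpoint_smooth :: "'b::real_normed_vector set \<Rightarrow> ('b \<Rightarrow> real) \<Rightarrow> bool" where
  "midpoint_smooth S f \<longleftrightarrow> (\<exists>L\<ge>0. \<forall>p\<in>S. \<forall>q\<in>S. \<bar>f p\<bar> \<le> L \<and> \<bar>f p - f q\<bar> \<le> L * dist p q \<and>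
     \<bar>f (midpoint p q) - (f p + f q) / 2\<bar> \<le> L * (dist p q)\<^sup>2)"

lemma midpoint_smoothE:
  assumes "midpoint_smooth S f"
  obtains L where "0 \<le> L" "\<And>p. p \<in> S \<Longrightarrow> \<bar>f p\<bar> \<le> L"
    "\<And>p q. p \<in> S \<Longrightarrow> q \<in> S \<Longrightarrow> \<bar>f p - f q\<bar> \<le> L * dist p q"
    "\<And>p q. p \<in> S \<Longrightarrow> q \<in> S \<Longrightarrow> \<bar>f (midpoint p q) - (f p + f q) / 2\<bar> \<le> L * (dist p q)\<^sup>2"
  using assms unfolding midpoint_smooth_def by blast

lemma midpoint_smoothI:
  assumes "\<And>p. p \<in> S \<Longrightarrow> \<bar>f p\<bar> \<le> A" "0 \<le> A"
    "\<And>p q. p \<in> S \<Longrightarrow> q \<in> S \<Longrightarrow> \<bar>f p - f q\<bar> \<le> B * dist p q"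
    "\<And>p q. p \<in> S \<Longrightarrow> q \<in> S \<Longrightarrow> \<bar>f (midpoint p q) - (f p + f q) / 2\<bar> \<le> C * (dist p q)\<^sup>2"
  shows "midpoint_smooth S f"
  unfolding midpoint_smooth_def
proof (intro exI[of _ "max A (max B C)"] conjI ballI)
  fix p q assume pq: "p \<in> S" "q \<in> S"
  show "\<bar>f p\<bar> \<le> max A (max B C)" using assms(1)[OF pq(1)] by simp
  have "B * dist p q \<le> max A (max B C) * dist p q" by (intro mult_right_mono) auto
  with assms(3)[OF pq] show "\<bar>f p - f q\<bar> \<le> max A (max B C) * dist p q" by linarith
  have "C * (dist p q)\<^sup>2 \<le> max A (max B C) * (dist p q)\<^sup>2" by (intro mult_right_mono) auto
  with assms(4)[OF pq]
  show "\<bar>f (midpoint p q) - (f p + f q) / 2\<bar> \<le> max A (max B C) * (dist p q)\<^sup>2" by linarith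
qed (use assms(2) in auto)

lemma midpoint_smooth_affine:
  fixes f :: "'b::real_normed_vector \<Rightarrow> real"
  assumes "bounded_linear f" "bounded S"
  shows "midpoint_smooth S (\<lambda>p. f p + c)"
proof -
  interpret bounded_linear f by fact
  obtain K where K: "\<And>x. norm (f x) \<le> norm x * K" "0 < K" using pos_bounded by blast
  obtain A where A: "\<And>x. x \<in> S \<Longrightarrow> norm x \<le> A" "0 < A" using assms(2) by (meson bounded_pos)
  show ?thesis
  proof (rule midpoint_smoothI[of S _ "A * K + \<bar>c\<bar>" K 0])
    fix p q assume "p \<in> S" "q \<in> S"
    show "\<bar>f p + c\<bar> \<le> A * K + \<bar>c\<bar>"
    proof -
      have "\<bar>f p\<bar> \<le> norm p * K" using K(1)[of p] by simp
      also have "\<dots> \<le> A * K" using A(1)[OF \<open>p \<in> S\<close>] K(2) by (intro mult_right_mono) auto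
      finally show ?thesis by linarith
    qed
    show "\<bar>f p + c - (f q + c)\<bar> \<le> K * dist p q"
      using K(1)[of "p - q"] by (simp add: diff dist_norm mult.commute)
    show "\<bar>f (midpoint p q) + c - (f p + c + (f q + c)) / 2\<bar> \<le> 0 * (dist p q)\<^sup>2"
      by (simp add: midpoint_def scaleR add field_simps)
  qed (use A K in auto)
qed

lemma midpoint_smooth_const: "midpoint_smooth S (\<lambda>p. c)"
  by (rule midpoint_smoothI[of S _ "\<bar>c\<bar>" 0 0]) auto

lemma midpoint_smooth_add:
  assumes "midpoint_smooth S f" "midpoint_smooth S h"
  shows "midpoint_smooth S (\<lambda>p. f p + h p)"
proof -
  obtain L where L: "0 \<le> L" "\<And>p. p \<in> S \<Longrightarrow> \<bar>f p\<bar> \<le> L"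
    "\<And>p q. p \<in> S \<Longrightarrow> q \<in> S \<Longrightarrow> \<bar>f p - f q\<bar> \<le> L * dist p q"
    "\<And>p q. p \<in> S \<Longrightarrow> q \<in> S \<Longrightarrow> \<bar>f (midpoint p q) - (f p + f q) / 2\<bar> \<le> L * (dist p q)\<^sup>2"
    using midpoint_smoothE[OF assms(1)] by blast
  obtain K where K: "0 \<le> K" "\<And>p. p \<in> S \<Longrightarrow> \<bar>h p\<bar> \<le> K"
    "\<And>p q. p \<in> S \<Longrightarrow> q \<in> S \<Longrightarrow> \<bar>h p - h q\<bar> \<le> K * dist p q"
    "\<And>p q. p \<in> S \<Longrightarrow> q \<in> S \<Longrightarrow> \<bar>h (midpoint p q) - (h p + h q) / 2\<bar> \<le> K * (dist p q)\<^sup>2"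
    using midpoint_smoothE[OF assms(2)] by blast
  show ?thesis
  proof (rule midpoint_smoothI[of S _ "L + K" "L + K" "L + K"])
    fix p q assume pq: "p \<in> S" "q \<in> S"
    show "\<bar>f p + h p\<bar> \<le> L + K" using L(2) K(2) pq(1) abs_triangle_ineq by (smt (verit))
    show "\<bar>f p + h p - (f q + h q)\<bar> \<le> (L + K) * dist p q"
      using L(3)[OF pq] K(3)[OF pq] by (simp add: distrib_right)
    show "\<bar>f (midpoint p q) + h (midpoint p q) - (f p + h p + (f q + h q)) / 2\<bar> \<le> (L + K) * (dist p q)\<^sup>2"
      using L(4)[OF pq] K(4)[OF pq] by (simp add: distrib_right abs_le_iff field_simps)
  qed (use L K in auto)
qed

text \<open>A Leibniz rule for midpoint defects: the mean of the products exceeds the product of the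
  means by (f p - f q)(h p - h q)/4, which the two Lipschitz clauses bound by the squared distance.
  Convexity keeps the midpoint in \<open>S\<close>, where \<open>h\<close> is bounded.\<close>

lemma midpoint_smooth_mult:
  assumes "midpoint_smooth S f" "midpoint_smooth S h" "convex S"
  shows "midpoint_smooth S (\<lambda>p. f p * h p)"
proof -
  obtain L where L: "0 \<le> L" "\<And>p. p \<in> S \<Longrightarrow> \<bar>f p\<bar> \<le> L"
    "\<And>p q. p \<in> S \<Longrightarrow> q \<in> S \<Longrightarrow> \<bar>f p - f q\<bar> \<le> L * dist p q"
    "\<And>p q. p \<in> S \<Longrightarrow> q \<in> S \<Longrightarrow> \<bar>f (midpoint p q) - (f p + f q) / 2\<bar> \<le> L * (dist p q)\<^sup>2"
    using midpoint_smoothE[OF assms(1)] by blast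
  obtain K where K: "0 \<le> K" "\<And>p. p \<in> S \<Longrightarrow> \<bar>h p\<bar> \<le> K"
    "\<And>p q. p \<in> S \<Longrightarrow> q \<in> S \<Longrightarrow> \<bar>h p - h q\<bar> \<le> K * dist p q"
    "\<And>p q. p \<in> S \<Longrightarrow> q \<in> S \<Longrightarrow> \<bar>h (midpoint p q) - (h p + h q) / 2\<bar> \<le> K * (dist p q)\<^sup>2"
    using midpoint_smoothE[OF assms(2)] by blast
  show ?thesis
  proof (rule midpoint_smoothI[of S _ "L * K" "2 * L * K" "3 * L * K"])
    fix p q assume pq: "p \<in> S" "q \<in> S"
    define d where "d = dist p q"
    have d: "0 \<le> d" unfolding d_def by simp
    have m: "midpoint p q \<in> S"
      using convexD[OF assms(3) pq, of "1/2" "1/2"] by (simp add: midpoint_def scaleR_right_distrib)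
    show "\<bar>f p * h p\<bar> \<le> L * K" unfolding abs_mult using L(1,2) K(2) pq by (intro mult_mono) auto
    have "\<bar>f p * h p - f q * h q\<bar> = \<bar>(f p - f q) * h p + f q * (h p - h q)\<bar>"
      by (simp add: algebra_simps)
    also have "\<dots> \<le> \<bar>f p - f q\<bar> * \<bar>h p\<bar> + \<bar>f q\<bar> * \<bar>h p - h q\<bar>"
      using abs_triangle_ineq[of "(f p - f q) * h p" "f q * (h p - h q)"] by (simp only: abs_mult)
    also have "\<dots> \<le> (L * d) * K + L * (K * d)"
      unfolding d_def using L K pq by (intro add_mono mult_mono) auto
    finally show "\<bar>f p * h p - f q * h q\<bar> \<le> 2 * L * K * dist p q"
      by (simp add: d_def algebra_simps)
    define fm hm where "fm = f (midpoint p q)" and "hm = h (midpoint p q)"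
    define fa ha where "fa = (f p + f q) / 2" and "ha = (h p + h q) / 2"
    have fa: "\<bar>fa\<bar> \<le> L" unfolding fa_def using L(2)[OF pq(1)] L(2)[OF pq(2)] by simp
    have "\<bar>fm * hm - (f p * h p + f q * h q) / 2\<bar>
        = \<bar>(fm - fa) * hm + fa * (hm - ha) + - ((f p - f q) * (h p - h q) / 4)\<bar>"
      unfolding fa_def ha_def by (rule arg_cong[of _ _ abs]) (simp add: field_simps)
    also have "\<dots> \<le> \<bar>fm - fa\<bar> * \<bar>hm\<bar> + \<bar>fa\<bar> * \<bar>hm - ha\<bar> + \<bar>f p - f q\<bar> * \<bar>h p - h q\<bar> / 4"
    proof -
      have "\<bar>a + b + - (c / 4)\<bar> \<le> \<bar>a\<bar> + \<bar>b\<bar> + \<bar>c\<bar> / 4" for a b c :: real by linarith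
      from this[of "(fm - fa) * hm" "fa * (hm - ha)" "(f p - f q) * (h p - h q)"]
      show ?thesis by (simp only: abs_mult)
    qed
    also have "\<dots> \<le> (L * d\<^sup>2) * K + L * (K * d\<^sup>2) + (L * d) * (K * d)"
    proof -
      have "\<bar>f p - f q\<bar> * \<bar>h p - h q\<bar> \<le> (L * d) * (K * d)"
        unfolding d_def using L K pq by (intro mult_mono) auto
      moreover have "0 \<le> (L * d) * (K * d)" using L K d by simp
      moreover have "\<bar>fm - fa\<bar> * \<bar>hm\<bar> \<le> (L * d\<^sup>2) * K"
        unfolding d_def fm_def fa_def hm_def using L K pq m by (intro mult_mono) auto
      moreover have "\<bar>fa\<bar> * \<bar>hm - ha\<bar> \<le> L * (K * d\<^sup>2)"
        unfolding d_def hm_def ha_def using L K pq m fa by (intro mult_mono) auto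
      ultimately show ?thesis by linarith
    qed
    finally show "\<bar>f (midpoint p q) * h (midpoint p q) - (f p * h p + f q * h q) / 2\<bar>
        \<le> 3 * L * K * (dist p q)\<^sup>2"
      by (simp add: d_def fm_def hm_def power2_eq_square algebra_simps)
  qed (use L K in auto)
qed

lemma midpoint_smooth_inverse:
  assumes "midpoint_smooth S f" "convex S" and ge: "\<And>p. f p \<ge> 1"
  shows "midpoint_smooth S (\<lambda>p. 1 / f p)"
proof -
  obtain L where L: "0 \<le> L" "\<And>p. p \<in> S \<Longrightarrow> \<bar>f p\<bar> \<le> L"
    "\<And>p q. p \<in> S \<Longrightarrow> q \<in> S \<Longrightarrow> \<bar>f p - f q\<bar> \<le> L * dist p q"
    "\<And>p q. p \<in> S \<Longrightarrow> q \<in> S \<Longrightarrow> \<bar>f (midpoint p q) - (f p + f q) / 2\<bar> \<le> L * (dist p q)\<^sup>2"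
    using midpoint_smoothE[OF assms(1)] by blast
  have shrink: "\<bar>x / y\<bar> \<le> \<bar>x\<bar>" if "1 \<le> y" for x y :: real
    using that by (simp add: divide_le_eq mult_left_mono[of 1 y "\<bar>x\<bar>", simplified])
  have one: "1 \<le> u * v" if "1 \<le> u" "1 \<le> v" for u v :: real
    using mult_mono[OF that] that by simp
  show ?thesis
  proof (rule midpoint_smoothI[of S _ 1 L "L + L\<^sup>2"])
    fix p q assume pq: "p \<in> S" "q \<in> S"
    have fp: "f p \<ge> 1" "f q \<ge> 1" "f (midpoint p q) \<ge> 1" by (rule ge)+
    show "\<bar>1 / f p\<bar> \<le> 1" using fp by simp
    have "\<bar>1 / f p - 1 / f q\<bar> = \<bar>(f q - f p) / (f p * f q)\<bar>"
      using fp by (simp add: field_simps)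
    also have "\<dots> \<le> \<bar>f q - f p\<bar>" using fp by (intro shrink one)
    finally show "\<bar>1 / f p - 1 / f q\<bar> \<le> L * dist p q"
      using L(3)[OF pq] by (simp add: abs_minus_commute)
    define fm fa where "fm = f (midpoint p q)" and "fa = (f p + f q) / 2"
    have fa: "fa \<ge> 1" unfolding fa_def using fp by simp
    have fm: "fm \<ge> 1" unfolding fm_def using fp by simp
    have "1 / fm - (1 / f p + 1 / f q) / 2 = (1 / fm - 1 / fa) + (1 / fa - (1 / f p + 1 / f q) / 2)"
      by simp
    also have "1 / fm - 1 / fa = (fa - fm) / (fm * fa)" using fm fa by (simp add: field_simps)
    also have "1 / fa - (1 / f p + 1 / f q) / 2 = - ((f p - f q)\<^sup>2 / (2 * (f p + f q) * (f p * f q)))"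
    proof -
      have "f p \<noteq> 0" "f q \<noteq> 0" "f p + f q \<noteq> 0" using fp by auto
      then show ?thesis unfolding fa_def by (simp add: divide_simps power2_eq_square) algebra
    qed
    finally have "\<bar>1 / fm - (1 / f p + 1 / f q) / 2\<bar> \<le>
        \<bar>(fa - fm) / (fm * fa)\<bar> + \<bar>(f p - f q)\<^sup>2 / (2 * (f p + f q) * (f p * f q))\<bar>"
      using abs_triangle_ineq4 by (simp only: add_uminus_conv_diff)
    also have "\<dots> \<le> \<bar>fa - fm\<bar> + \<bar>(f p - f q)\<^sup>2\<bar>"
      using fp fa fm by (intro add_mono shrink one) auto
    also have "\<dots> \<le> L * (dist p q)\<^sup>2 + (L * dist p q)\<^sup>2"
    proof (intro add_mono)
      show "\<bar>fa - fm\<bar> \<le> L * (dist p q)\<^sup>2"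
        using L(4)[OF pq] unfolding fa_def fm_def by (simp add: abs_minus_commute)
      show "\<bar>(f p - f q)\<^sup>2\<bar> \<le> (L * dist p q)\<^sup>2"
        using power_mono[OF L(3)[OF pq], of 2] by simp
    qed
    finally show "\<bar>1 / f (midpoint p q) - (1 / f p + 1 / f q) / 2\<bar> \<le> (L + L\<^sup>2) * (dist p q)\<^sup>2"
      by (simp add: fm_def power_mult_distrib distrib_right)
  qed simp
qed

text \<open>The case \<delta> = 1 of \<open>far\<close> confines the search to a compact ball, which
  gives existence. Two distinct minimizers would be beaten by their midpoint. Arbitrary \<delta>
  then yields convergence. The equivalence in the conclusion states existence and uniqueness in the
  form in which the minimizers of \<open>Q2\<close> can be read off.\<close>

lemma eventually_unique_minimizer:
  fixes F :: "nat \<Rightarrow> 'b::euclidean_space \<Rightarrow> real"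
  assumes cont: "\<And>n. continuous_on UNIV (F n)"
    and far: "\<And>\<delta>. 0 < \<delta> \<Longrightarrow> \<forall>\<^sub>F n in sequentially. \<forall>p. \<delta> \<le> dist p p0 \<longrightarrow> F n p0 < F n p"
    and convex: "\<forall>\<^sub>F n in sequentially. \<forall>p\<in>cball p0 1. \<forall>q\<in>cball p0 1. p \<noteq> q \<longrightarrow>
      F n (midpoint p q) < (F n p + F n q) / 2"
  obtains N P where "\<And>n p. N \<le> n \<Longrightarrow> (\<forall>q. F n p \<le> F n q) \<longleftrightarrow> p = P n" "P \<longlonglongrightarrow> p0"
proof -
  have ev: "\<forall>\<^sub>F n in sequentially. \<exists>!p. \<forall>q. F n p \<le> F n q"
    using far[of 1, OF zero_less_one] convex
  proof eventually_elim
    case (elim n)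
    have "\<exists>p\<in>cball p0 1. \<forall>q\<in>cball p0 1. F n p \<le> F n q"
      by (intro continuous_attains_inf continuous_on_subset[OF cont]) auto
    then obtain p where p: "p \<in> cball p0 1" "\<And>q. q \<in> cball p0 1 \<Longrightarrow> F n p \<le> F n q" by blast
    have glob: "F n p \<le> F n q" for q
    proof (cases "q \<in> cball p0 1")
      case False
      then have "F n p0 < F n q" using elim(1) by (auto simp: dist_commute)
      with p(2)[of p0] show ?thesis by simp
    qed (rule p)
    show ?case
    proof (intro ex1I[of _ p] allI glob)
      fix q assume q: "\<forall>r. F n q \<le> F n r"
      have "q \<in> cball p0 1"
        using elim(1) q by (metis dist_commute linorder_not_le mem_cball nle_le)
      then have "F n (midpoint p q) < (F n p + F n q) / 2" if "p \<noteq> q"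
        using elim(2) p(1) that by blast
      moreover have "F n p = F n q" using q glob by (simp add: antisym)
      moreover have "F n p \<le> F n (midpoint p q)" by (rule glob)
      ultimately show "q = p" by fastforce
    qed
  qed
  then obtain N where N: "\<And>n. N \<le> n \<Longrightarrow> \<exists>!p. \<forall>q. F n p \<le> F n q"
    by (auto simp: eventually_sequentially)
  define P where "P n = (THE p. \<forall>q. F n p \<le> F n q)" for n
  have P: "\<forall>q. F n (P n) \<le> F n q" if "N \<le> n" for n
    unfolding P_def by (rule theI'[OF N[OF that]])
  have iff: "(\<forall>q. F n p \<le> F n q) \<longleftrightarrow> p = P n" if "N \<le> n" for n p
    using N[OF that] P[OF that] by blast
  have "P \<longlonglongrightarrow> p0"
  proof (rule tendstoI)
    fix e :: real assume "0 < e"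
    have "\<forall>\<^sub>F n in sequentially. N \<le> n" by (rule eventually_ge_at_top)
    with far[OF \<open>0 < e\<close>] show "\<forall>\<^sub>F n in sequentially. dist (P n) p0 < e"
      by eventually_elim (use P in \<open>meson linorder_not_le\<close>)
  qed
  with iff that show thesis by blast
qed

section \<open>Least squares with two outliers\<close>

text \<open>The invariant combination of the three affected residuals, divided by the squared norm
  of its weight vector (a^2, a, 1). The contaminated observations cancel from it, and at the optimal
  outlier sizes the residuals are exactly a^2, a and 1 times this number.\<close>

definition profile_slack :: "nat \<Rightarrow> (nat \<Rightarrow> real) \<Rightarrow> real \<times> real \<Rightarrow> real" where
  "profile_slack s y p = (case p of (a, m) \<Rightarrow>
     (y (s + 2) - a ^ 3 * y (s - 1) - m * (1 + a + a\<^sup>2)) / (1 + a\<^sup>2 + a ^ 4))"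

definition profiled_Q2 :: "nat \<Rightarrow> nat \<Rightarrow> (nat \<Rightarrow> real) \<Rightarrow> real \<times> real \<Rightarrow> real" where
  "profiled_Q2 s n y p = (case p of (a, m) \<Rightarrow>
     (\<Sum>k\<in>{1..n} - {s, s + 1, s + 2}. (y k - a * y (k - 1) - m)\<^sup>2)
     + (1 + a\<^sup>2 + a ^ 4) * (profile_slack s y p)\<^sup>2)"

text \<open>Solves A - t1 = a^2 l for \<open>t1\<close>, with l the slack; it is written in the
  shape of the limit in the theorem, so that continuity in (a, m) alone gives the
  convergence.\<close>

definition profile_theta1 :: "nat \<Rightarrow> (nat \<Rightarrow> real) \<Rightarrow> real \<times> real \<Rightarrow> real" where
  "profile_theta1 s y p = (case p of (a, m) \<Rightarrow>
     y s + (- a * (1 + a\<^sup>2) * y (s - 1) - a\<^sup>2 * y (s + 2) - (1 - a ^ 3) * m) / (1 + a\<^sup>2 + a ^ 4))"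

definition profile_theta2 :: "nat \<Rightarrow> (nat \<Rightarrow> real) \<Rightarrow> real \<times> real \<Rightarrow> real" where
  "profile_theta2 s y p = (case p of (a, m) \<Rightarrow>
     y (s + 1) + (- a\<^sup>2 * y (s - 1) - a * (1 + a\<^sup>2) * y (s + 2) - (1 - a ^ 3) * m) / (1 + a\<^sup>2 + a ^ 4))"

lemma quartic_pos: "0 < 1 + a\<^sup>2 + (a::real) ^ 4"
proof -
  have "a ^ 4 = (a\<^sup>2)\<^sup>2" by (simp add: power2_eq_square power4_eq_xxxx)
  then show ?thesis by (simp add: add_pos_nonneg)
qed

text \<open>Pythagoras in three dimensions: for every choice of outlier sizes the residual vector
  has the same inner product with (a^2, a, 1). Its squared length is therefore that of the
  projection plus the squared distance to it, and the three squares are the coordinates of this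
  distance.\<close>

lemma Q2_eq_profiled:
  "Q2 s n y (a, m, t1, t2) = profiled_Q2 s n y (a, m)
     + (t1 - profile_theta1 s y (a, m))\<^sup>2
     + (t2 - profile_theta2 s y (a, m) - a * (t1 - profile_theta1 s y (a, m)))\<^sup>2
     + (a * (t2 - profile_theta2 s y (a, m)))\<^sup>2"
proof -
  define l where "l = profile_slack s y (a, m)"
  define D where "D = 1 + a\<^sup>2 + a ^ 4"
  define A where "A = y s - a * y (s - 1) - m"
  define B where "B = y (s + 1) - a * y s - m"
  define C where "C = y (s + 2) - a * y (s + 1) - m"
  have D: "D \<noteq> 0" unfolding D_def using quartic_pos[of a] by simp
  have R: "a\<^sup>2 * A + a * B + C = D * l"
  proof -
    have "D * l = y (s + 2) - a ^ 3 * y (s - 1) - m * (1 + a + a\<^sup>2)"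
      unfolding l_def profile_slack_def prod.case D_def[symmetric] using D by simp
    then show ?thesis unfolding A_def B_def C_def by algebra
  qed
  have 1: "profile_theta1 s y (a, m) = A - a\<^sup>2 * l"
    unfolding l_def profile_slack_def profile_theta1_def A_def prod.case D_def[symmetric]
    using D by (simp add: divide_simps) (simp add: D_def, algebra)
  \<comment> \<open>The second outlier size is taken from the middle residual, B + a t1 - t2 = a l;
    the last one, C + a t2 = l, would require a division by \<open>a\<close>, which may be
    zero.\<close>
  have 2: "profile_theta2 s y (a, m) = B + a * (A - a\<^sup>2 * l) - a * l"
    unfolding l_def profile_slack_def profile_theta2_def A_def B_def prod.case D_def[symmetric]
    using D by (simp add: divide_simps) (simp add: D_def, algebra)
  have "(A - t1)\<^sup>2 + (B + a * t1 - t2)\<^sup>2 + (C + a * t2)\<^sup>2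
      = D * l\<^sup>2 + (A - t1 - a\<^sup>2 * l)\<^sup>2 + (B + a * t1 - t2 - a * l)\<^sup>2 + (C + a * t2 - l)\<^sup>2"
    using R unfolding D_def by algebra
  moreover have "C + a * t2 - l = a * (t2 - profile_theta2 s y (a, m))"
    using R unfolding 2 D_def by algebra
  moreover have "Q2 s n y (a, m, t1, t2) =
      profiled_Q2 s n y (a, m) - D * l\<^sup>2 + ((A - t1)\<^sup>2 + (B + a * t1 - t2)\<^sup>2 + (C + a * t2)\<^sup>2)"
    unfolding Q2_def profiled_Q2_def A_def B_def C_def D_def l_def by (simp add: algebra_simps)
  moreover have "(A - t1 - a\<^sup>2 * l)\<^sup>2 = (t1 - profile_theta1 s y (a, m))\<^sup>2"
    unfolding 1 by algebra
  moreover have "(B + a * t1 - t2 - a * l)\<^sup>2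
      = (t2 - profile_theta2 s y (a, m) - a * (t1 - profile_theta1 s y (a, m)))\<^sup>2"
    unfolding 1 2 by algebra
  ultimately show ?thesis by simp
qed

text \<open>Minimization in two stages: \<open>lower\<close> and \<open>attained\<close> identify
  \<open>profiled_Q2\<close> as the minimum of \<open>Q2\<close> over the outlier sizes, and the
  squares in \<open>Q2_eq_profiled\<close> show that this minimum has a single minimizer.\<close>

lemma Q2_minimizer_iff:
  assumes uniq: "\<And>r. (\<forall>q. profiled_Q2 s n y r \<le> profiled_Q2 s n y q) \<longleftrightarrow> r = r0"
  shows "(\<forall>q. Q2 s n y p \<le> Q2 s n y q) \<longleftrightarrow>
    p = (fst r0, snd r0, profile_theta1 s y r0, profile_theta2 s y r0)"
proof -
  have lower: "profiled_Q2 s n y (a, m) \<le> Q2 s n y (a, m, t1, t2)" for a m t1 t2 :: real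
    unfolding Q2_eq_profiled by simp
  have attained: "Q2 s n y (a, m, profile_theta1 s y (a, m), profile_theta2 s y (a, m)) = profiled_Q2 s n y (a, m)"
    for a m :: real unfolding Q2_eq_profiled by simp
  obtain a0 m0 where r0: "r0 = (a0, m0)" by (cases r0)
  have min0: "profiled_Q2 s n y r0 \<le> profiled_Q2 s n y q" for q using uniq by blast
  show ?thesis
  proof
    assume p: "\<forall>q. Q2 s n y p \<le> Q2 s n y q"
    obtain a m t1 t2 where pe: "p = (a, m, t1, t2)" by (metis prod.exhaust)
    have "profiled_Q2 s n y (a, m) \<le> profiled_Q2 s n y q" for q
      using lower[of a m t1 t2] p attained pe by (metis order_trans prod.exhaust)
    then have r: "(a, m) = r0" using uniq by blast
    have "Q2 s n y p \<le> profiled_Q2 s n y (a, m)" using p attained by metis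
    \<comment> \<open>The first two squares form a triangular system that fixes \<open>t1\<close>
      and with it \<open>t2\<close>. The third is zero for every \<open>t2\<close> when a = 0, so it
      is discarded.\<close>
    then have "(t1 - profile_theta1 s y (a, m))\<^sup>2
      + (t2 - profile_theta2 s y (a, m) - a * (t1 - profile_theta1 s y (a, m)))\<^sup>2 \<le> 0"
      unfolding pe Q2_eq_profiled by (smt (verit) zero_le_power2)
    then have "t1 - profile_theta1 s y (a, m) = 0"
      "t2 - profile_theta2 s y (a, m) - a * (t1 - profile_theta1 s y (a, m)) = 0"
      using sum_power2_le_zero_iff by blast+
    then show "p = (fst r0, snd r0, profile_theta1 s y r0, profile_theta2 s y r0)"
      unfolding pe r[symmetric] by simp
  next
    assume p: "p = (fst r0, snd r0, profile_theta1 s y r0, profile_theta2 s y r0)"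
    show "\<forall>q. Q2 s n y p \<le> Q2 s n y q"
    proof
      fix q :: "real \<times> real \<times> real \<times> real"
      obtain a m t1 t2 where q: "q = (a, m, t1, t2)" by (metis prod.exhaust)
      have "Q2 s n y p = profiled_Q2 s n y r0" unfolding p r0 using attained by simp
      also have "\<dots> \<le> profiled_Q2 s n y (a, m)" by (rule min0)
      also have "\<dots> \<le> Q2 s n y q" unfolding q by (rule lower)
      finally show "Q2 s n y p \<le> Q2 s n y q" .
    qed
  qed
qed

lemma continuous_on_profiled_Q2: "continuous_on UNIV (profiled_Q2 s n y)"
  unfolding profiled_Q2_def profile_slack_def split_beta
  using quartic_pos by (intro continuous_intros) (metis less_irrefl)+

text \<open>With R the numerator of the slack and D the quartic, the term equals R^2/D: one
  reciprocal of a polynomial that is at least 1, times polynomials in the coordinates. Powers are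
  spelled out as products to match the closure rules.\<close>

lemma midpoint_smooth_profile_term:
  assumes "bounded S" "convex S"
  shows "midpoint_smooth S (\<lambda>p. (1 + (fst p)\<^sup>2 + fst p ^ 4) * (profile_slack s y p)\<^sup>2)"
proof -
  have F: "midpoint_smooth S fst"
    using midpoint_smooth_affine[OF bounded_linear_fst assms(1), of 0] by simp
  have G: "midpoint_smooth S snd"
    using midpoint_smooth_affine[OF bounded_linear_snd assms(1), of 0] by simp
  note M = midpoint_smooth_mult[OF _ _ assms(2)]
  note I = F G M midpoint_smooth_add midpoint_smooth_const
  have D: "midpoint_smooth S (\<lambda>p. 1 + fst p * fst p + fst p * fst p * (fst p * fst p))"
    by (intro I)
  have "midpoint_smooth S (\<lambda>p. 1 / (1 + fst p * fst p + fst p * fst p * (fst p * fst p)))"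
    by (rule midpoint_smooth_inverse[OF D assms(2)]) simp
  moreover have "midpoint_smooth S (\<lambda>p. y (s + 2) + (- y (s - 1)) * (fst p * fst p * fst p) + (- 1) * (snd p * (1 + fst p + fst p * fst p)))"
    (is "midpoint_smooth S ?R") by (intro I)
  ultimately have "midpoint_smooth S (\<lambda>p. ?R p * ?R p * (1 / (1 + fst p * fst p + fst p * fst p * (fst p * fst p))))"
    by (intro M)
  also have "(\<lambda>p. ?R p * ?R p * (1 / (1 + fst p * fst p + fst p * fst p * (fst p * fst p))))
     = (\<lambda>p. (1 + (fst p)\<^sup>2 + fst p ^ 4) * (profile_slack s y p)\<^sup>2)"
  proof
    fix p :: "real \<times> real"
    obtain a m where p: "p = (a, m)" by (cases p)
    define D where "D = 1 + a\<^sup>2 + a ^ 4"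
    define u where "u = y (s + 2) - a ^ 3 * y (s - 1) - m * (1 + a + a\<^sup>2)"
    have 1: "1 + fst p * fst p + fst p * fst p * (fst p * fst p) = D"
      unfolding p D_def by (simp add: power2_eq_square power4_eq_xxxx)
    have 2: "1 + (fst p)\<^sup>2 + fst p ^ 4 = D" unfolding p D_def by simp
    have 3: "?R p = u"
      unfolding p u_def by (simp add: power2_eq_square power3_eq_cube)
    have 4: "profile_slack s y p = u / D" unfolding p profile_slack_def u_def D_def by simp
    have "D \<noteq> 0" unfolding D_def using quartic_pos[of a] by simp
    then show "?R p * ?R p * (1 / (1 + fst p * fst p + fst p * fst p * (fst p * fst p)))
       = (1 + (fst p)\<^sup>2 + fst p ^ 4) * (profile_slack s y p)\<^sup>2"
      unfolding 1 2 3 4 by (simp add: power2_eq_square)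
  qed
  finally show ?thesis .
qed

section \<open>Least squares along a single sample path with prescribed averages\<close>

locale outlier_sample =
  fixes x y :: "nat \<Rightarrow> real" and \<alpha> \<mu> m1 d :: real and s :: nat
  assumes s: "1 \<le> s"
    and yx: "\<And>k. k \<noteq> s \<Longrightarrow> k \<noteq> s + 1 \<Longrightarrow> y k = x k"
    and e0: "(\<lambda>n. (\<Sum>k<n. x (Suc k) - \<alpha> * x k - \<mu>) / real n) \<longlonglongrightarrow> 0"
    and ex: "(\<lambda>n. (\<Sum>k<n. (x (Suc k) - \<alpha> * x k - \<mu>) * x k) / real n) \<longlonglongrightarrow> 0"
    and z0: "(\<lambda>n. (\<Sum>k<n. x k - m1) / real n) \<longlonglongrightarrow> 0"
    and d: "0 < d" "d \<le> 1"
    and zz: "\<forall>\<^sub>F n in sequentially. d * real n \<le> (\<Sum>k<n. (x k - m1)\<^sup>2)"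
begin

definition err :: "nat \<Rightarrow> real" where "err k = x (Suc k) - \<alpha> * x k - \<mu>"
definition dev :: "nat \<Rightarrow> real" where "dev k = x k - m1"
text \<open>Transitions are indexed by their starting time, so the residuals at s, s+1, s+2 are
  those starting at s-1, s, s+1. Since s is positive, s-1 is a genuine predecessor and the three
  indices are distinct.\<close>

definition clean :: "nat \<Rightarrow> nat set" where "clean n = {..<n} - {s - 1, s, s + 1}"
definition truth :: "real \<times> real" where "truth = (\<alpha>, \<mu>)"
text \<open>Centering the regressor at $m_1$ turns the parameter increment $(b, c)$ into $(b, c + b m_1)$;
  this constant compares the two norms.\<close>
definition \<kappa> :: real where "\<kappa> = 2 + 2 * m1\<^sup>2"

lemma distortion: "0 < \<kappa>" "b\<^sup>2 + c\<^sup>2 \<le> \<kappa> * (b\<^sup>2 + (c + b * m1)\<^sup>2)"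
proof -
  show "0 < \<kappa>" unfolding \<kappa>_def by (simp add: add_pos_nonneg)
  have "0 \<le> ((c + b * m1) + b * m1)\<^sup>2" by simp
  moreover have "0 \<le> m1\<^sup>2 * (c + b * m1)\<^sup>2" by simp
  moreover have "0 \<le> b\<^sup>2" by simp
  ultimately show "b\<^sup>2 + c\<^sup>2 \<le> \<kappa> * (b\<^sup>2 + (c + b * m1)\<^sup>2)"
    unfolding \<kappa>_def by (simp add: power2_eq_square algebra_simps)
qed

lemma dist_Pair_sq: "(dist (a, m) (a', m'))\<^sup>2 = (a - a')\<^sup>2 + (m - m')\<^sup>2" for a a' m m' :: real
  by (simp add: dist_Pair_Pair dist_real_def)

lemma sum_clean:
  assumes "s + 2 \<le> n"
  shows "(\<Sum>k\<in>clean n. f k) = (\<Sum>k<n. f k) - (\<Sum>k\<in>{s - 1, s, s + 1}. f k :: real)"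
  unfolding clean_def using assms by (intro sum_diff) auto

text \<open>Both endpoints of a clean transition are uncontaminated, so its residual is the true
  error minus an affine function of the regressor. Centering at \<open>m1\<close> makes regressor
  and constant asymptotically orthogonal.\<close>

lemma profiled_eq:
  assumes n: "s + 2 \<le> n"
  shows "profiled_Q2 s n y p = (\<Sum>k\<in>clean n. (err k - (fst p - \<alpha>) * dev k - (snd p - \<mu> + (fst p - \<alpha>) * m1))\<^sup>2)
     + (1 + (fst p)\<^sup>2 + fst p ^ 4) * (profile_slack s y p)\<^sup>2"
proof -
  obtain a m where p: "p = (a, m)" by (cases p)
  have "{1..n} - {s, s + 1, s + 2} = Suc ` clean n"
  proof -
    have "{1..n} = Suc ` {..<n}" by (simp add: image_Suc_lessThan)
    moreover have "{s, s + 1, s + 2} = Suc ` {s - 1, s, s + 1}" using s by auto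
    ultimately show ?thesis unfolding clean_def by (simp add: image_set_diff)
  qed
  then have "(\<Sum>k\<in>{1..n} - {s, s + 1, s + 2}. (y k - a * y (k - 1) - m)\<^sup>2)
      = (\<Sum>k\<in>clean n. (y (Suc k) - a * y k - m)\<^sup>2)"
    by (simp add: sum.reindex)
  also have "\<dots> = (\<Sum>k\<in>clean n. (err k - (a - \<alpha>) * dev k - (m - \<mu> + (a - \<alpha>) * m1))\<^sup>2)"
  proof (intro sum.cong refl)
    fix k assume "k \<in> clean n"
    then have "y k = x k" "y (Suc k) = x (Suc k)" unfolding clean_def using s by (auto intro!: yx)
    then show "(y (Suc k) - a * y k - m)\<^sup>2 = (err k - (a - \<alpha>) * dev k - (m - \<mu> + (a - \<alpha>) * m1))\<^sup>2"
      unfolding err_def dev_def by (simp add: algebra_simps)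
  qed
  finally show ?thesis unfolding profiled_Q2_def p by simp
qed

lemma small_clean:
  assumes "(\<lambda>n. (\<Sum>k<n. f k) / real n) \<longlonglongrightarrow> 0" "0 < \<eta>"
  shows "\<forall>\<^sub>F n in sequentially. \<bar>\<Sum>k\<in>clean n. f k\<bar> \<le> \<eta> * real n"
proof -
  let ?c = "\<Sum>k\<in>{s - 1, s, s + 1}. f k"
  have "(\<lambda>n. (\<Sum>k<n. f k) / real n - ?c / real n) \<longlonglongrightarrow> 0 - 0"
    by (intro tendsto_diff assms(1) lim_const_over_n)
  then have "\<forall>\<^sub>F n in sequentially. \<bar>(\<Sum>k<n. f k) / real n - ?c / real n\<bar> < \<eta>"
    using assms(2) by (auto dest: tendstoD simp: dist_real_def)
  then show ?thesis
    using eventually_ge_at_top[of "s + 2"]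
  proof eventually_elim
    case (elim n)
    then have "\<bar>(\<Sum>k\<in>clean n. f k) / real n\<bar> < \<eta>" by (simp only: sum_clean diff_divide_distrib)
    with elim(2) show ?case by (simp add: divide_less_eq)
  qed
qed

text \<open>After centering, the design is nearly diagonal and nearly orthogonal to the errors; one
  \<eta> measures every deviation, including the three removed indices. The product
  \<open>err k * dev k\<close> combines the weighted error average with \<open>m1\<close> times the
  plain one.\<close>

lemma design_bounds:
  assumes \<eta>: "0 < \<eta>"
  shows "\<forall>\<^sub>F n in sequentially. 0 < n \<and> \<bar>\<Sum>k\<in>clean n. err k * dev k\<bar> \<le> \<eta> * real n \<and> \<bar>\<Sum>k\<in>clean n. err k\<bar> \<le> \<eta> * real n
     \<and> \<bar>\<Sum>k\<in>clean n. dev k\<bar> \<le> \<eta> * real n \<and> (d - \<eta>) * real n \<le> (\<Sum>k\<in>clean n. (dev k)\<^sup>2) \<and> (d - \<eta>) * real n \<le> real (card (clean n))"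
proof -
  have "(\<lambda>n. (\<Sum>k<n. err k * x k) / real n - m1 * ((\<Sum>k<n. err k) / real n)) \<longlonglongrightarrow> 0 - m1 * 0"
    unfolding err_def by (intro tendsto_intros ex e0)
  then have ez: "(\<lambda>n. (\<Sum>k<n. err k * dev k) / real n) \<longlonglongrightarrow> 0"
    by (simp add: dev_def right_diff_distrib left_diff_distrib sum_subtractf diff_divide_distrib sum_distrib_left mult_ac)
  have big: "\<forall>\<^sub>F n in sequentially. c \<le> \<eta> * real n" for c
    using eventually_ge_at_top[of "nat \<lceil>c / \<eta>\<rceil>"]
    by eventually_elim (use \<eta> in \<open>simp add: nat_le_iff ceiling_le_iff divide_le_eq mult.commute\<close>)
  show ?thesis
    using small_clean[OF ez \<eta>] small_clean[OF e0[folded err_def] \<eta>] small_clean[OF z0[folded dev_def] \<eta>]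
      zz[folded dev_def] big[of "\<Sum>k\<in>{s - 1, s, s + 1}. (dev k)\<^sup>2"] big[of 3] eventually_ge_at_top[of "s + 2"]
  proof eventually_elim
    case (elim n)
    have "(\<Sum>k\<in>clean n. (dev k)\<^sup>2) = (\<Sum>k<n. (dev k)\<^sup>2) - (\<Sum>k\<in>{s - 1, s, s + 1}. (dev k)\<^sup>2)"
      using elim(7) by (rule sum_clean)
    moreover have "real (card (clean n)) \<ge> real n - 3"
    proof -
      have "(\<Sum>k\<in>clean n. 1) = (\<Sum>k<n. 1) - (\<Sum>k\<in>{s - 1, s, s + 1}. 1 :: real)"
        using elim(7) by (rule sum_clean)
      moreover have "card {s - 1, s, s + 1} = 3" using s by (auto simp: card_insert_if)
      ultimately show ?thesis by simp
    qed
    \<comment> \<open>Here \<open>d\<close> being at most 1 lets it bound the constant regressor as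
      well as the centered one.\<close>
    moreover have "d * real n \<le> real n" using d by (simp add: mult_left_le_one_le)
    ultimately show ?case using elim unfolding left_diff_distrib by (intro conjI) linarith+
  qed
qed

text \<open>Expand the squares and bound the cross terms by 2|t| \<le> 1 + t^2 and 2|b c| \<le> b^2
  + c^2. The diagonal, the mixed term and the two error terms each cost one \<eta> in the quadratic
  coefficient, and the error terms also leave the constant 2\<eta>. The second bound concerns the
  pure quadratic form that measures midpoint convexity.\<close>

lemma quadratic_growth:
  assumes \<eta>: "0 < \<eta>"
  shows "\<forall>\<^sub>F n in sequentially. \<forall>b c.
      (\<Sum>k\<in>clean n. (err k)\<^sup>2) + real n * ((d - 3 * \<eta>) * (b\<^sup>2 + c\<^sup>2) - 2 * \<eta>) \<le> (\<Sum>k\<in>clean n. (err k - b * dev k - c)\<^sup>2)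
    \<and> real n * ((d - 2 * \<eta>) * (b\<^sup>2 + c\<^sup>2)) \<le> (\<Sum>k\<in>clean n. (b * dev k + c)\<^sup>2)"
  using design_bounds[OF \<eta>]
proof eventually_elim
  case (elim n)
  define N where "N = real n"
  define u v w Z k where "u = (\<Sum>k\<in>clean n. err k * dev k)" and "v = (\<Sum>k\<in>clean n. err k)" and "w = (\<Sum>k\<in>clean n. dev k)"
    and "Z = (\<Sum>k\<in>clean n. (dev k)\<^sup>2)" and "k = real (card (clean n))"
  have bd: "\<bar>u\<bar> \<le> \<eta> * N" "\<bar>v\<bar> \<le> \<eta> * N" "\<bar>w\<bar> \<le> \<eta> * N" "(d - \<eta>) * N \<le> Z" "(d - \<eta>) * N \<le> k"
    using elim unfolding N_def u_def v_def w_def Z_def k_def by auto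
  have cross: "- (\<eta> * N * (1 + t\<^sup>2)) \<le> 2 * t * a" if "\<bar>a\<bar> \<le> \<eta> * N" for t a
  proof -
    have "\<bar>2 * t * a\<bar> = 2 * \<bar>t\<bar> * \<bar>a\<bar>" by (simp add: abs_mult)
    also have "\<dots> \<le> 2 * \<bar>t\<bar> * (\<eta> * N)" using that by (intro mult_left_mono) auto
    also have "\<dots> \<le> (1 + t\<^sup>2) * (\<eta> * N)"
    proof (intro mult_right_mono)
      have "0 \<le> (\<bar>t\<bar> - 1)\<^sup>2" by simp
      then show "2 * \<bar>t\<bar> \<le> 1 + t\<^sup>2" by (simp add: power2_eq_square algebra_simps)
    qed (use \<eta> N_def in auto)
    finally show ?thesis by (simp add: mult.commute)
  qed
  have cross2: "- (\<eta> * N * (b\<^sup>2 + c\<^sup>2)) \<le> 2 * b * c * w" for b c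
  proof -
    have "\<bar>2 * b * c * w\<bar> = (2 * \<bar>b\<bar> * \<bar>c\<bar>) * \<bar>w\<bar>" by (simp add: abs_mult)
    also have "\<dots> \<le> (2 * \<bar>b\<bar> * \<bar>c\<bar>) * (\<eta> * N)" using bd by (intro mult_left_mono) auto
    also have "\<dots> \<le> (b\<^sup>2 + c\<^sup>2) * (\<eta> * N)"
    proof (intro mult_right_mono)
      have "0 \<le> (\<bar>b\<bar> - \<bar>c\<bar>)\<^sup>2" by simp
      then show "2 * \<bar>b\<bar> * \<bar>c\<bar> \<le> b\<^sup>2 + c\<^sup>2" by (simp add: power2_eq_square algebra_simps)
    qed (use \<eta> N_def in auto)
    finally show ?thesis by (simp add: mult.commute)
  qed
  have sq: "(d - \<eta>) * N * (b\<^sup>2 + c\<^sup>2) \<le> b\<^sup>2 * Z + c\<^sup>2 * k" for b c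
    using mult_left_mono[OF bd(4), of "b\<^sup>2"] mult_left_mono[OF bd(5), of "c\<^sup>2"]
    by (simp add: algebra_simps)
  have ex1: "(\<Sum>k\<in>clean n. (err k - b * dev k - c)\<^sup>2)
      = (\<Sum>k\<in>clean n. (err k)\<^sup>2) + 2 * (- b) * u + 2 * (- c) * v + (b\<^sup>2 * Z + c\<^sup>2 * k) + 2 * b * c * w" for b c
  proof -
    have "(\<Sum>k\<in>clean n. (err k - b * dev k - c)\<^sup>2) = (\<Sum>k\<in>clean n. (err k)\<^sup>2 + (- (2 * b)) * (err k * dev k) + (- (2 * c)) * err k
       + (b\<^sup>2 * (dev k)\<^sup>2 + c\<^sup>2) + 2 * b * c * dev k)"
      by (intro sum.cong refl) algebra
    then show ?thesis
      unfolding u_def v_def w_def Z_def k_def by (simp only: sum.distrib sum_distrib_left[symmetric] sum_constant mult_minus_left mult_minus_right)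
         (simp add: sum_negf sum_distrib_left[symmetric])
  qed
  have ex2: "(\<Sum>k\<in>clean n. (b * dev k + c)\<^sup>2) = (b\<^sup>2 * Z + c\<^sup>2 * k) + 2 * b * c * w" for b c
  proof -
    have "(\<Sum>k\<in>clean n. (b * dev k + c)\<^sup>2) = (\<Sum>k\<in>clean n. (b\<^sup>2 * (dev k)\<^sup>2 + c\<^sup>2) + 2 * b * c * dev k)"
      by (intro sum.cong refl) algebra
    then show ?thesis
      unfolding w_def Z_def k_def by (simp add: sum.distrib sum_distrib_left)
  qed
  show ?case
  proof (intro allI conjI)
    fix b c
    show "(\<Sum>k\<in>clean n. (err k)\<^sup>2) + real n * ((d - 3 * \<eta>) * (b\<^sup>2 + c\<^sup>2) - 2 * \<eta>) \<le> (\<Sum>k\<in>clean n. (err k - b * dev k - c)\<^sup>2)"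
      unfolding ex1 N_def[symmetric]
      using cross[OF bd(1), of "- b"] cross[OF bd(2), of "- c"] cross2[of b c] sq[of b c]
      by (simp add: algebra_simps)
    show "real n * ((d - 2 * \<eta>) * (b\<^sup>2 + c\<^sup>2)) \<le> (\<Sum>k\<in>clean n. (b * dev k + c)\<^sup>2)"
      unfolding ex2 N_def[symmetric]
      using cross2[of b c] sq[of b c] by (simp add: algebra_simps)
  qed
qed

text \<open>The least squares part gains a multiple of n outside the \<delta>-ball, uniformly in the
  parameter. The profile term is a fixed number at the truth and nonnegative elsewhere, so it is
  eventually outweighed.\<close>

lemma profiled_far:
  assumes \<delta>: "0 < \<delta>"
  shows "\<forall>\<^sub>F n in sequentially. \<forall>p. \<delta> \<le> dist p truth \<longrightarrow> profiled_Q2 s n y truth < profiled_Q2 s n y p"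
proof -
  define g where "g p = (1 + (fst p)\<^sup>2 + fst p ^ 4) * (profile_slack s y p)\<^sup>2" for p
  have g: "0 \<le> g p" for p unfolding g_def using quartic_pos[of "fst p"] by simp
  define \<rho> where "\<rho> = d * \<delta>\<^sup>2 / \<kappa>"
  have \<rho>: "0 < \<rho>" unfolding \<rho>_def using d \<delta> distortion(1) by simp
  \<comment> \<open>With \<eta> at most d/6, half of the quadratic coefficient survives, leaving at
    least \<rho>/2; with \<eta> at most \<rho>/8 the constant 2\<eta> takes no more than \<rho>/4 of
    it.\<close>
  define \<eta> where "\<eta> = min (d / 6) (\<rho> / 8)"
  have \<eta>: "0 < \<eta>" "\<eta> \<le> d / 6" "\<eta> \<le> \<rho> / 8" unfolding \<eta>_def using d \<rho> by auto
  have "\<forall>\<^sub>F n in sequentially. g truth < real n * (\<rho> / 4)"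
  proof -
    obtain n0 :: nat where "g truth / (\<rho> / 4) < real n0" using reals_Archimedean2 by blast
    then have "g truth < real n * (\<rho> / 4)" if "n0 \<le> n" for n
      using that \<rho> by (simp add: divide_less_eq) (smt (verit) mult_right_mono of_nat_le_iff)
    then show ?thesis by (auto simp: eventually_sequentially)
  qed
  with quadratic_growth[OF \<eta>(1)] eventually_ge_at_top[of "s + 2"]
  show ?thesis
  proof eventually_elim
    case (elim n)
    show ?case
    proof (intro allI impI)
      fix p assume p: "\<delta> \<le> dist p truth"
      define b c where "b = fst p - \<alpha>" and "c = snd p - \<mu>"
      have "\<delta>\<^sup>2 \<le> (dist p truth)\<^sup>2" using \<delta> p by (intro power_mono) auto
      also have "\<dots> = b\<^sup>2 + c\<^sup>2" unfolding truth_def b_def c_def by (cases p) (simp only: dist_Pair_sq fst_conv snd_conv)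
      also have "\<dots> \<le> \<kappa> * (b\<^sup>2 + (c + b * m1)\<^sup>2)" by (rule distortion)
      finally have "d * \<delta>\<^sup>2 \<le> d * (\<kappa> * (b\<^sup>2 + (c + b * m1)\<^sup>2))" using d by (intro mult_left_mono) auto
      then have "\<rho> \<le> d * (b\<^sup>2 + (c + b * m1)\<^sup>2)"
        unfolding \<rho>_def using distortion(1) by (simp add: divide_le_eq mult_ac)
      moreover have "d / 2 * (b\<^sup>2 + (c + b * m1)\<^sup>2) \<le> (d - 3 * \<eta>) * (b\<^sup>2 + (c + b * m1)\<^sup>2)"
        using \<eta> by (intro mult_right_mono) auto
      ultimately have "\<rho> / 4 \<le> (d - 3 * \<eta>) * (b\<^sup>2 + (c + b * m1)\<^sup>2) - 2 * \<eta>" using \<eta>(3) by linarith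
      then have "real n * (\<rho> / 4) \<le> real n * ((d - 3 * \<eta>) * (b\<^sup>2 + (c + b * m1)\<^sup>2) - 2 * \<eta>)"
        by (intro mult_left_mono) auto
      then have "(\<Sum>k\<in>clean n. (err k)\<^sup>2) + real n * (\<rho> / 4) \<le> (\<Sum>k\<in>clean n. (err k - b * dev k - (c + b * m1))\<^sup>2)"
        using elim(1)[rule_format, of b "c + b * m1"] by linarith
      moreover have "profiled_Q2 s n y truth = (\<Sum>k\<in>clean n. (err k)\<^sup>2) + g truth"
        unfolding profiled_eq[OF elim(2)] g_def by (simp add: truth_def)
      moreover have "profiled_Q2 s n y p = (\<Sum>k\<in>clean n. (err k - b * dev k - (c + b * m1))\<^sup>2) + g p"
        unfolding profiled_eq[OF elim(2)] g_def b_def c_def ..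
      ultimately show "profiled_Q2 s n y truth < profiled_Q2 s n y p" using elim(3) g[of p] by linarith
    qed
  qed
qed

text \<open>Residuals are affine in the parameters, so by the parallelogram identity their sum of
  squares drops at the midpoint by exactly a quarter of a quadratic form of order n. The profile
  term can spoil this by at most a fixed multiple of the squared distance.\<close>

lemma profiled_strictly_midconvex:
  "\<forall>\<^sub>F n in sequentially. \<forall>p\<in>cball truth 1. \<forall>q\<in>cball truth 1. p \<noteq> q \<longrightarrow>
     profiled_Q2 s n y (midpoint p q) < (profiled_Q2 s n y p + profiled_Q2 s n y q) / 2"
proof -
  define g where "g p = (1 + (fst p)\<^sup>2 + fst p ^ 4) * (profile_slack s y p)\<^sup>2" for p
  have "midpoint_smooth (cball truth 1) g"
    unfolding g_def[abs_def] by (intro midpoint_smooth_profile_term) auto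
  then obtain L where L: "0 \<le> L" "\<And>p q. p \<in> cball truth 1 \<Longrightarrow> q \<in> cball truth 1 \<Longrightarrow>
      \<bar>g (midpoint p q) - (g p + g q) / 2\<bar> \<le> L * (dist p q)\<^sup>2"
    by (rule midpoint_smoothE) blast
  \<comment> \<open>Taking \<eta> = d/4 leaves the coefficient d/2; the parallelogram quarter makes
    it d/8, and \<kappa> converts back to the uncentered distance.\<close>
  define \<rho> where "\<rho> = d / (8 * \<kappa>)"
  have \<rho>: "0 < \<rho>" unfolding \<rho>_def using d distortion(1) by simp
  have \<eta>: "0 < d / 4" using d by simp
  have "\<forall>\<^sub>F n in sequentially. L < real n * \<rho>"
  proof -
    obtain n0 :: nat where "L / \<rho> < real n0" using reals_Archimedean2 by blast
    then have "L < real n * \<rho>" if "n0 \<le> n" for n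
      using that \<rho> by (simp add: divide_less_eq) (smt (verit) mult_right_mono of_nat_le_iff)
    then show ?thesis by (auto simp: eventually_sequentially)
  qed
  with quadratic_growth[OF \<eta>] eventually_ge_at_top[of "s + 2"]
  show ?thesis
  proof eventually_elim
    case (elim n)
    show ?case
    proof (intro ballI impI)
      fix p q assume pq: "p \<in> cball truth 1" "q \<in> cball truth 1" "p \<noteq> q"
      define b c where "b = fst p - fst q" and "c = snd p - snd q"
      define h where "h r k = err k - (fst r - \<alpha>) * dev k - (snd r - \<mu> + (fst r - \<alpha>) * m1)" for r k
      have F: "profiled_Q2 s n y r = (\<Sum>k\<in>clean n. (h r k)\<^sup>2) + g r" for r
        unfolding profiled_eq[OF elim(2)] g_def h_def ..
      have mid: "fst (midpoint p q) = (fst p + fst q) / 2" "snd (midpoint p q) = (snd p + snd q) / 2"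
        by (simp_all add: midpoint_def)
      have "(h (midpoint p q) k)\<^sup>2 = ((h p k)\<^sup>2 + (h q k)\<^sup>2) / 2 - (b * dev k + (c + b * m1))\<^sup>2 / 4" for k
        unfolding h_def mid b_def c_def by (simp add: field_simps power2_eq_square)
      then have "(\<Sum>k\<in>clean n. (h (midpoint p q) k)\<^sup>2)
          = ((\<Sum>k\<in>clean n. (h p k)\<^sup>2) + (\<Sum>k\<in>clean n. (h q k)\<^sup>2)) / 2 - (\<Sum>k\<in>clean n. (b * dev k + (c + b * m1))\<^sup>2) / 4"
        by (simp add: sum_subtractf sum.distrib sum_divide_distrib[symmetric])
      moreover have "real n * \<rho> * (dist p q)\<^sup>2 \<le> (\<Sum>k\<in>clean n. (b * dev k + (c + b * m1))\<^sup>2) / 4"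
      proof -
        have "(dist p q)\<^sup>2 = b\<^sup>2 + c\<^sup>2"
          unfolding b_def c_def by (cases p, cases q) (simp only: dist_Pair_sq fst_conv snd_conv)
        also have "\<dots> \<le> \<kappa> * (b\<^sup>2 + (c + b * m1)\<^sup>2)" by (rule distortion)
        finally have "real n * \<rho> * (dist p q)\<^sup>2 \<le> real n * \<rho> * (\<kappa> * (b\<^sup>2 + (c + b * m1)\<^sup>2))"
          using \<rho> by (intro mult_left_mono) auto
        also have "\<dots> = real n * ((\<rho> * \<kappa>) * (b\<^sup>2 + (c + b * m1)\<^sup>2))" by simp
        also have "\<rho> * \<kappa> = d / 8" unfolding \<rho>_def using distortion(1) by simp
        also have "real n * (d / 8 * (b\<^sup>2 + (c + b * m1)\<^sup>2)) = real n * ((d - 2 * (d / 4)) * (b\<^sup>2 + (c + b * m1)\<^sup>2)) / 4"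
          by simp
        also have "\<dots> \<le> (\<Sum>k\<in>clean n. (b * dev k + (c + b * m1))\<^sup>2) / 4"
          using elim(1) by (intro divide_right_mono) auto
        finally show ?thesis .
      qed
      moreover have "L * (dist p q)\<^sup>2 < real n * \<rho> * (dist p q)\<^sup>2"
        using elim(3) pq(3) by (intro mult_strict_right_mono) auto
      moreover have "g (midpoint p q) \<le> (g p + g q) / 2 + L * (dist p q)\<^sup>2" using L(2)[OF pq(1,2)] by linarith
      ultimately show "profiled_Q2 s n y (midpoint p q) < (profiled_Q2 s n y p + profiled_Q2 s n y q) / 2"
        unfolding F by (simp add: field_simps)
    qed
  qed
qed

text \<open>The outlier estimates are continuous functions of the consistent pair (a, m) with four
  observations held fixed. Their limits therefore depend on the path through these
  observations.\<close>

theorem Q2_minimizer_consistent: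
  shows "\<exists>n0. \<forall>n\<ge>n0. \<exists>!p. \<forall>q. Q2 s n y p \<le> Q2 s n y q"
    and "(\<lambda>n. fst (Q2_argmin s n y)) \<longlonglongrightarrow> \<alpha>"
    and "(\<lambda>n. fst (snd (Q2_argmin s n y))) \<longlonglongrightarrow> \<mu>"
    and "(\<lambda>n. fst (snd (snd (Q2_argmin s n y)))) \<longlonglongrightarrow> profile_theta1 s y (\<alpha>, \<mu>)"
    and "(\<lambda>n. snd (snd (snd (Q2_argmin s n y)))) \<longlonglongrightarrow> profile_theta2 s y (\<alpha>, \<mu>)"
proof -
  obtain N P where NP: "\<And>n p. N \<le> n \<Longrightarrow> (\<forall>q. profiled_Q2 s n y p \<le> profiled_Q2 s n y q) \<longleftrightarrow> p = P n"
    and P: "P \<longlonglongrightarrow> truth"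
    using eventually_unique_minimizer[of "\<lambda>n. profiled_Q2 s n y" truth, OF continuous_on_profiled_Q2
        profiled_far profiled_strictly_midconvex] by blast
  define A where "A n = (fst (P n), snd (P n), profile_theta1 s y (P n), profile_theta2 s y (P n))" for n
  have A: "(\<forall>q. Q2 s n y p \<le> Q2 s n y q) \<longleftrightarrow> p = A n" if "N \<le> n" for n p
    unfolding A_def by (rule Q2_minimizer_iff[OF NP[OF that]])
  show "\<exists>n0. \<forall>n\<ge>n0. \<exists>!p. \<forall>q. Q2 s n y p \<le> Q2 s n y q"
  proof (intro exI allI impI)
    fix n assume "N \<le> n"
    then show "\<exists>!p. \<forall>q. Q2 s n y p \<le> Q2 s n y q" unfolding A[OF \<open>N \<le> n\<close>] by simp
  qed
  have "Q2_argmin s n y = A n" if "N \<le> n" for n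
    unfolding Q2_argmin_def A[OF that] by simp
  then have ev: "\<forall>\<^sub>F n in sequentially. A n = Q2_argmin s n y"
    by (intro eventually_sequentiallyI[of N]) simp
  have P1: "(\<lambda>n. fst (P n)) \<longlonglongrightarrow> \<alpha>" using tendsto_fst[OF P] by (simp add: truth_def)
  have P2: "(\<lambda>n. snd (P n)) \<longlonglongrightarrow> \<mu>" using tendsto_snd[OF P] by (simp add: truth_def)
  have D: "1 + \<alpha>\<^sup>2 + \<alpha> ^ 4 \<noteq> 0" using quartic_pos[of \<alpha>] by simp
  have T1: "(\<lambda>n. profile_theta1 s y (P n)) \<longlonglongrightarrow> profile_theta1 s y (\<alpha>, \<mu>)"
    unfolding profile_theta1_def split_beta fst_conv snd_conv by (intro tendsto_intros P1 P2 D)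
  have T2: "(\<lambda>n. profile_theta2 s y (P n)) \<longlonglongrightarrow> profile_theta2 s y (\<alpha>, \<mu>)"
    unfolding profile_theta2_def split_beta fst_conv snd_conv by (intro tendsto_intros P1 P2 D)
  have AL: "A \<longlonglongrightarrow> (\<alpha>, \<mu>, profile_theta1 s y (\<alpha>, \<mu>), profile_theta2 s y (\<alpha>, \<mu>))"
    unfolding A_def[abs_def] by (intro tendsto_Pair P1 P2 T1 T2)
  have L: "(\<lambda>n. Q2_argmin s n y) \<longlonglongrightarrow> (\<alpha>, \<mu>, profile_theta1 s y (\<alpha>, \<mu>), profile_theta2 s y (\<alpha>, \<mu>))"
    by (rule Lim_transform_eventually[OF AL ev])
  show "(\<lambda>n. fst (Q2_argmin s n y)) \<longlonglongrightarrow> \<alpha>"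
    using tendsto_fst[OF L] by simp
  show "(\<lambda>n. fst (snd (Q2_argmin s n y))) \<longlonglongrightarrow> \<mu>"
    using tendsto_fst[OF tendsto_snd[OF L]] by simp
  show "(\<lambda>n. fst (snd (snd (Q2_argmin s n y)))) \<longlonglongrightarrow> profile_theta1 s y (\<alpha>, \<mu>)"
    using tendsto_fst[OF tendsto_snd[OF tendsto_snd[OF L]]] by simp
  show "(\<lambda>n. snd (snd (snd (Q2_argmin s n y)))) \<longlonglongrightarrow> profile_theta2 s y (\<alpha>, \<mu>)"
    using tendsto_snd[OF tendsto_snd[OF tendsto_snd[OF L]]] by simp
qed

end

section \<open>The INAR(1) chain\<close>

locale inar = prob_space M for M :: "'a measure" +
  fixes X0 :: "'a \<Rightarrow> nat" and eps :: "nat \<Rightarrow> 'a \<Rightarrow> nat" and xi :: "nat \<Rightarrow> nat \<Rightarrow> 'a \<Rightarrow> nat"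
    and \<alpha> \<mu> :: real
  assumes \<alpha>: "0 < \<alpha>" "\<alpha> < 1"
    and indep: "indep_vars (\<lambda>_. count_space UNIV) (inar_vars X0 eps xi) inar_index_set"
    and eps_distr: "\<And>k. k \<ge> 1 \<Longrightarrow> distr M (count_space UNIV) (eps k) = distr M (count_space UNIV) (eps 1)"
    and eps_square: "integrable M (\<lambda>\<omega>. (real (eps 1 \<omega>))\<^sup>2)"
    and eps_nonzero: "measure M {\<omega> \<in> space M. eps 1 \<omega> \<noteq> 0} > 0"
    and xi_distr: "\<And>k j. k \<ge> 1 \<Longrightarrow> j \<ge> 1 \<Longrightarrow>
           distr M (count_space UNIV) (xi k j) = measure_pmf (map_pmf of_bool (bernoulli_pmf \<alpha>))"
    and X0_square: "integrable M (\<lambda>\<omega>. (real (X0 \<omega>))\<^sup>2)"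
    and \<mu>_def: "\<mu> = expectation (\<lambda>\<omega>. real (eps 1 \<omega>))"
begin

section \<open>Information carried by blocks of primitive variables\<close>

abbreviation "X \<equiv> inar_X X0 eps xi"

text \<open>The $\sigma$-algebra generated by the primitive variables with index in $A$.\<close>
definition info :: "inar_idx set \<Rightarrow> 'a measure" where
  "info A = vimage_algebra (space M) (\<lambda>\<omega>. restrict (\<lambda>i. inar_vars X0 eps xi i \<omega>) A)
     (PiM A (\<lambda>_. count_space UNIV))"

lemma space_info [simp]: "space (info A) = space M"
  by (simp add: info_def)

lemma measurable_info_coordinate:
  assumes "i \<in> A"
  shows "inar_vars X0 eps xi i \<in> measurable (info A) (count_space UNIV)"
proof -
  have "(\<lambda>\<omega>. restrict (\<lambda>i. inar_vars X0 eps xi i \<omega>) A) \<in> measurable (info A) (PiM A (\<lambda>_. count_space UNIV))"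
    unfolding info_def by (intro measurable_vimage_algebra1) (auto simp: space_PiM)
  from measurable_compose[OF this measurable_component_singleton[OF assms]]
  show ?thesis using assms by (simp cong: measurable_cong)
qed

lemma measurable_info_mono:
  assumes "A \<subseteq> B" "f \<in> measurable (info A) N"
  shows "f \<in> measurable (info B) N"
proof -
  have "id \<in> measurable (info B) (info A)"
    unfolding info_def[of A]
  proof (rule measurable_vimage_algebra2)
    have "(\<lambda>\<omega>. \<lambda>i\<in>A. inar_vars X0 eps xi i \<omega>) \<in> measurable (info B) (PiM A (\<lambda>_. count_space UNIV))"
      using assms(1) by (intro measurable_restrict measurable_info_coordinate) auto
    then show "(\<lambda>x. \<lambda>i\<in>A. inar_vars X0 eps xi i (id x)) \<in> measurable (info B) (PiM A (\<lambda>_. count_space UNIV))"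
      by simp
  qed auto
  from measurable_compose[OF this assms(2)] show ?thesis by simp
qed

lemma measurable_from_info:
  assumes "A \<subseteq> inar_index_set" "f \<in> measurable (info A) N"
  shows "f \<in> measurable M N"
proof -
  have "id \<in> measurable M (info A)"
    unfolding info_def
  proof (rule measurable_vimage_algebra2)
    have "(\<lambda>\<omega>. \<lambda>i\<in>A. inar_vars X0 eps xi i \<omega>) \<in> measurable M (PiM A (\<lambda>_. count_space UNIV))"
      using assms(1) indep by (intro measurable_restrict) (auto simp: indep_vars_def)
    then show "(\<lambda>x. \<lambda>i\<in>A. inar_vars X0 eps xi i (id x)) \<in> measurable M (PiM A (\<lambda>_. count_space UNIV))"
      by simp
  qed auto
  from measurable_compose[OF this assms(2)] show ?thesis by simp
qed

text \<open>Restrictions of an independent family to disjoint index sets are independent vectors,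
  and the events generated by \<open>f\<close> and \<open>g\<close> are among those of their blocks.
  Measurability with respect to \<open>info\<close> thus replaces explicit factorizations.\<close>

lemma indep_var_info:
  assumes AB: "A \<inter> B = {}" "A \<subseteq> inar_index_set" "B \<subseteq> inar_index_set"
    and f: "f \<in> measurable (info A) N" and g: "g \<in> measurable (info B) N'"
  shows "indep_var N f N' g"
proof -
  let ?r = "\<lambda>A \<omega>. restrict (\<lambda>i. inar_vars X0 eps xi i \<omega>) A"
  let ?P = "\<lambda>A. PiM A (\<lambda>_. count_space UNIV)"
  have sub: "sigma_sets (space M) {h -` C \<inter> space M | C. C \<in> sets N''}
      \<subseteq> sigma_sets (space M) {?r A -` C \<inter> space M | C. C \<in> sets (?P A)}"
    if "h \<in> measurable (info A) N''" for h :: "'a \<Rightarrow> 'd" and A N''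
  proof (rule sigma_sets_subseteq, safe)
    fix C assume "C \<in> sets N''"
    then have "h -` C \<inter> space M \<in> sets (info A)"
      using measurable_sets[OF that] by simp
    then show "\<exists>C'. h -` C \<inter> space M = ?r A -` C' \<inter> space M \<and> C' \<in> sets (?P A)"
      unfolding info_def by (subst (asm) sets_vimage_algebra2) (auto simp: space_PiM)
  qed
  have "indep_set (sigma_sets (space M) {?r A -` C \<inter> space M | C. C \<in> sets (?P A)})
      (sigma_sets (space M) {?r B -` C \<inter> space M | C. C \<in> sets (?P B)})"
    using indep_var_restrict[OF indep AB] unfolding indep_var_eq by blast
  then have "indep_set (sigma_sets (space M) {f -` C \<inter> space M | C. C \<in> sets N})
      (sigma_sets (space M) {g -` C \<inter> space M | C. C \<in> sets N'})"
    unfolding indep_set_def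
    by (rule indep_sets_mono_sets) (use sub[OF f] sub[OF g] in \<open>auto split: bool.split\<close>)
  then show ?thesis
    unfolding indep_var_eq using measurable_from_info f g AB by auto
qed

text \<open>Together with \<open>current\<close>, this stands in for a filtration:
  \<open>past k\<close> determines the chain up to time k, and \<open>current (Suc k)\<close> is the
  fresh randomness of the next step. Disjointness of the two index sets does the work of
  conditioning.\<close>

definition past :: "nat \<Rightarrow> inar_idx set" where
  "past k = {InitIdx} \<union> {EpsIdx i | i. 1 \<le> i \<and> i \<le> k} \<union> {XiIdx i j | i j. 1 \<le> i \<and> i \<le> k \<and> 1 \<le> j}"

definition current :: "nat \<Rightarrow> inar_idx set" where
  "current k = {EpsIdx k} \<union> {XiIdx k j | j. 1 \<le> j}"

lemma past_current:
  "past k \<subseteq> inar_index_set" "1 \<le> k \<Longrightarrow> current k \<subseteq> inar_index_set"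
  "past k \<inter> current (Suc k) = {}" "current (Suc k) \<subseteq> past (Suc k)" "i \<le> k \<Longrightarrow> past i \<subseteq> past k"
  by (auto simp: past_def current_def inar_index_set_def)

lemma measurable_info_vars:
  "InitIdx \<in> A \<Longrightarrow> X0 \<in> measurable (info A) (count_space UNIV)"
  "EpsIdx k \<in> A \<Longrightarrow> eps k \<in> measurable (info A) (count_space UNIV)"
  "XiIdx k j \<in> A \<Longrightarrow> xi k j \<in> measurable (info A) (count_space UNIV)"
  using measurable_info_coordinate[of _ A] by (force simp: inar_vars_def[abs_def])+

lemma vars_measurable [measurable]:
  "X0 \<in> measurable M (count_space UNIV)"
  "1 \<le> k \<Longrightarrow> eps k \<in> measurable M (count_space UNIV)"
  "1 \<le> k \<Longrightarrow> 1 \<le> j \<Longrightarrow> xi k j \<in> measurable M (count_space UNIV)"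
  by (rule measurable_from_info[of inar_index_set], simp, rule measurable_info_vars,
      simp add: inar_index_set_def)+

text \<open>The step of the chain with its state frozen at a deterministic \<open>x\<close>. In this
  form it depends on the fresh randomness alone; the random state is substituted afterwards.\<close>

definition offspring :: "nat \<Rightarrow> nat \<Rightarrow> 'a \<Rightarrow> nat" where
  "offspring k x \<omega> = (\<Sum>j\<in>{1..x}. xi k j \<omega>) + eps k \<omega>"

lemma X_Suc: "X (Suc k) \<omega> = offspring (Suc k) (X k \<omega>) \<omega>"
  by (simp add: offspring_def)

lemma measurable_sum_nat:
  assumes "\<And>i. i \<in> I \<Longrightarrow> f i \<in> measurable N (count_space (UNIV :: nat set))"
  shows "(\<lambda>\<omega>. \<Sum>i\<in>I. f i \<omega>) \<in> measurable N (count_space UNIV)"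
  using assms by (induction I rule: infinite_finite_induct) auto

lemma measurable_info_offspring:
  assumes "EpsIdx k \<in> A" "\<And>j. 1 \<le> j \<Longrightarrow> j \<le> x \<Longrightarrow> XiIdx k j \<in> A"
  shows "offspring k x \<in> measurable (info A) (count_space UNIV)"
proof -
  note measurable_info_vars(2)[OF assms(1), measurable]
  have [measurable]: "(\<lambda>\<omega>. \<Sum>j\<in>{1..x}. xi k j \<omega>) \<in> measurable (info A) (count_space UNIV)"
    using assms by (intro measurable_sum_nat measurable_info_vars) auto
  show ?thesis unfolding offspring_def[abs_def] by measurable
qed

lemma measurable_info_X: "X k \<in> measurable (info (past k)) (count_space UNIV)"
proof (induction k)
  case 0
  have "X 0 = X0" by auto
  then show ?case using measurable_info_vars(1)[of "past 0"] by (simp add: past_def)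
next
  case (Suc k)
  have X: "X k \<in> measurable (info (past (Suc k))) (count_space UNIV)"
    by (rule measurable_info_mono[OF past_current(5) Suc]) simp
  have "(\<lambda>\<omega>. offspring (Suc k) (X k \<omega>) \<omega>) \<in> measurable (info (past (Suc k))) (count_space UNIV)"
    by (rule measurable_compose_countable[OF measurable_info_offspring X]) (auto simp: past_def)
  then show ?case by (simp only: X_Suc[abs_def])
qed

lemma X_measurable [measurable]: "X k \<in> measurable M (count_space UNIV)"
  by (rule measurable_from_info[OF past_current(1) measurable_info_X])

lemma AE_xi:
  assumes "1 \<le> k" "1 \<le> j"
  shows "AE \<omega> in M. xi k j \<omega> = 0 \<or> xi k j \<omega> = 1"
    and "prob {\<omega> \<in> space M. xi k j \<omega> = 1} = \<alpha>"
    and "prob {\<omega> \<in> space M. xi k j \<omega> = 0} = 1 - \<alpha>"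
proof -
  note [measurable] = vars_measurable(3)[OF assms]
  have "AE v in distr M (count_space UNIV) (xi k j). v = 0 \<or> v = 1"
    unfolding xi_distr[OF assms] by (subst AE_measure_pmf_iff) auto
  then show "AE \<omega> in M. xi k j \<omega> = 0 \<or> xi k j \<omega> = 1"
    by (subst (asm) AE_distr_iff) auto
  have *: "prob {\<omega> \<in> space M. xi k j \<omega> = v} = pmf (map_pmf of_bool (bernoulli_pmf \<alpha>)) v" for v
  proof -
    have "prob {\<omega> \<in> space M. xi k j \<omega> = v} = measure (distr M (count_space UNIV) (xi k j)) {v}"
      by (subst measure_distr) (auto intro!: arg_cong[where f=prob])
    then show ?thesis unfolding xi_distr[OF assms] by (simp add: measure_pmf_single)
  qed
  have "inj (of_bool :: bool \<Rightarrow> nat)" by (auto simp: inj_def)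
  from pmf_map_inj'[OF this, of "bernoulli_pmf \<alpha>" True] pmf_map_inj'[OF this, of "bernoulli_pmf \<alpha>" False]
  show "prob {\<omega> \<in> space M. xi k j \<omega> = 1} = \<alpha>" "prob {\<omega> \<in> space M. xi k j \<omega> = 0} = 1 - \<alpha>"
    unfolding * using \<alpha> by simp_all
qed

lemma eps_transfer:
  fixes h :: "nat \<Rightarrow> real"
  assumes "1 \<le> k"
  shows "integrable M (\<lambda>\<omega>. h (eps k \<omega>)) \<longleftrightarrow> integrable M (\<lambda>\<omega>. h (eps 1 \<omega>))"
    and "expectation (\<lambda>\<omega>. h (eps k \<omega>)) = expectation (\<lambda>\<omega>. h (eps 1 \<omega>))"
proof -
  have E: "integrable (distr M (count_space UNIV) (eps k)) h \<longleftrightarrow> integrable M (\<lambda>\<omega>. h (eps k \<omega>))"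
    "integral\<^sup>L (distr M (count_space UNIV) (eps k)) h = expectation (\<lambda>\<omega>. h (eps k \<omega>))" if "1 \<le> k" for k
    using vars_measurable(2)[OF that] by (simp_all add: integrable_distr_eq integral_distr)
  show "integrable M (\<lambda>\<omega>. h (eps k \<omega>)) \<longleftrightarrow> integrable M (\<lambda>\<omega>. h (eps 1 \<omega>))"
    using E(1)[OF assms] E(1)[OF order_refl] unfolding eps_distr[OF assms] by simp
  show "expectation (\<lambda>\<omega>. h (eps k \<omega>)) = expectation (\<lambda>\<omega>. h (eps 1 \<omega>))"
    using E(2)[OF assms] E(2)[OF order_refl] unfolding eps_distr[OF assms] by simp
qed

lemma expectation_mult_info:
  fixes f g :: "'a \<Rightarrow> real"
  assumes AB: "A \<inter> B = {}" "A \<subseteq> inar_index_set" "B \<subseteq> inar_index_set"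
    and f: "f \<in> borel_measurable (info A)" "integrable M f"
    and g: "g \<in> borel_measurable (info B)" "integrable M g"
  shows "integrable M (\<lambda>\<omega>. f \<omega> * g \<omega>)"
    and "expectation (\<lambda>\<omega>. f \<omega> * g \<omega>) = expectation f * expectation g"
  using indep_var_integrable[OF indep_var_info[OF AB f(1) g(1)] f(2) g(2)]
    indep_var_lebesgue_integral[OF indep_var_info[OF AB f(1) g(1)] f(2) g(2)] by auto

lemma measurable_real_info:
  "f \<in> measurable N (count_space UNIV) \<Longrightarrow> (\<lambda>\<omega>. real (f \<omega>)) \<in> borel_measurable N"
  by (rule measurable_compose[where g=real]) auto

section \<open>Moments of one step and of the chain\<close>

lemma centered_xi:
  assumes "1 \<le> k" "1 \<le> j"
  shows "integrable M (\<lambda>\<omega>. real (xi k j \<omega>) - \<alpha>)" "integrable M (\<lambda>\<omega>. (real (xi k j \<omega>) - \<alpha>)\<^sup>2)"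
    and "expectation (\<lambda>\<omega>. real (xi k j \<omega>) - \<alpha>) = 0"
    and "expectation (\<lambda>\<omega>. (real (xi k j \<omega>) - \<alpha>)\<^sup>2) \<le> 1"
proof -
  note [measurable] = vars_measurable(3)[OF assms]
  have bd: "AE \<omega> in M. \<bar>real (xi k j \<omega>) - \<alpha>\<bar> \<le> 1"
    using AE_xi(1)[OF assms] by eventually_elim (use \<alpha> in auto)
  then have bd2: "AE \<omega> in M. (real (xi k j \<omega>) - \<alpha>)\<^sup>2 \<le> 1"
    by eventually_elim (simp add: abs_square_le_1)
  show "integrable M (\<lambda>\<omega>. real (xi k j \<omega>) - \<alpha>)"
    by (rule integrable_const_bound[of _ 1]) (use bd in auto)
  show I2: "integrable M (\<lambda>\<omega>. (real (xi k j \<omega>) - \<alpha>)\<^sup>2)"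
    by (rule integrable_const_bound[of _ 1]) (use bd2 in auto)
  show "expectation (\<lambda>\<omega>. (real (xi k j \<omega>) - \<alpha>)\<^sup>2) \<le> 1"
    using integral_mono_AE[OF I2, of "\<lambda>_. 1"] bd2 by (simp add: prob_space)
  have "expectation (\<lambda>\<omega>. real (xi k j \<omega>) - \<alpha>) =
      expectation (\<lambda>\<omega>. indicator {\<omega> \<in> space M. xi k j \<omega> = 1} \<omega> - \<alpha>)"
    by (rule integral_cong_AE) (use AE_xi(1)[OF assms] in \<open>auto simp: indicator_def elim!: AE_mp\<close>)
  also have "\<dots> = 0"
    using AE_xi(2)[OF assms] integrable_event[of "{\<omega> \<in> space M. xi k j \<omega> = 1}"]
    by (subst Bochner_Integration.integral_diff) (auto simp: prob_space)
  finally show "expectation (\<lambda>\<omega>. real (xi k j \<omega>) - \<alpha>) = 0" .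
qed

definition \<tau> :: real where "\<tau> = expectation (\<lambda>\<omega>. (real (eps 1 \<omega>) - \<mu>)\<^sup>2)"

lemma \<tau>_nonneg: "0 \<le> \<tau>"
  unfolding \<tau>_def by simp

lemma eps_moments:
  assumes k: "1 \<le> k"
  shows "integrable M (\<lambda>\<omega>. real (eps k \<omega>) - \<mu>)" "integrable M (\<lambda>\<omega>. (real (eps k \<omega>) - \<mu>)\<^sup>2)"
    and "expectation (\<lambda>\<omega>. real (eps k \<omega>) - \<mu>) = 0"
    and "expectation (\<lambda>\<omega>. (real (eps k \<omega>) - \<mu>)\<^sup>2) = \<tau>"
proof -
  note [measurable] = vars_measurable(2)[of 1, simplified]
  have I: "integrable M (\<lambda>\<omega>. real (eps 1 \<omega>))"
    by (rule integrable_of_square) (use eps_square in auto)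
  show "integrable M (\<lambda>\<omega>. real (eps k \<omega>) - \<mu>)"
    using I by (subst eps_transfer(1)[OF k, of "\<lambda>n. real n - \<mu>"]) auto
  show "integrable M (\<lambda>\<omega>. (real (eps k \<omega>) - \<mu>)\<^sup>2)"
    using I eps_square by (subst eps_transfer(1)[OF k, of "\<lambda>n. (real n - \<mu>)\<^sup>2"]) (simp add: power2_diff)
  show "expectation (\<lambda>\<omega>. real (eps k \<omega>) - \<mu>) = 0"
    using I by (subst eps_transfer(2)[OF k, of "\<lambda>n. real n - \<mu>"]) (simp add: \<mu>_def prob_space)
  show "expectation (\<lambda>\<omega>. (real (eps k \<omega>) - \<mu>)\<^sup>2) = \<tau>"
    unfolding \<tau>_def by (rule eps_transfer(2)[OF k, of "\<lambda>n. (real n - \<mu>)\<^sup>2"])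
qed

text \<open>An integer valued innovation dominates the indicator of its being nonzero.\<close>

lemma \<mu>_pos: "0 < \<mu>"
proof -
  note [measurable] = vars_measurable(2)[of 1, simplified]
  have I: "integrable M (\<lambda>\<omega>. real (eps 1 \<omega>))"
    by (rule integrable_of_square) (use eps_square in auto)
  have "prob {\<omega> \<in> space M. eps 1 \<omega> \<noteq> 0} = expectation (indicator {\<omega> \<in> space M. eps 1 \<omega> \<noteq> 0})"
    by simp
  also have "\<dots> \<le> \<mu>"
    unfolding \<mu>_def
    by (rule integral_mono[OF integrable_event I]) (auto simp: indicator_def)
  finally show ?thesis using eps_nonzero by simp
qed

definition noise :: "nat \<Rightarrow> nat \<Rightarrow> 'a \<Rightarrow> real" where
  "noise k x \<omega> = real (offspring k x \<omega>) - \<alpha> * real x - \<mu>"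

lemma measurable_info_noise:
  assumes "EpsIdx k \<in> A" "\<And>j. 1 \<le> j \<Longrightarrow> j \<le> x \<Longrightarrow> XiIdx k j \<in> A"
  shows "noise k x \<in> borel_measurable (info A)"
  unfolding noise_def[abs_def]
  by (intro borel_measurable_diff measurable_real_info measurable_info_offspring assms) auto

text \<open>Individuals are added one at a time; each contributes an independent centered summand of
  variance at most 1. The crude constant suffices, since only linear growth in the state
  matters.\<close>

lemma noise_moments:
  assumes k: "1 \<le> k"
  shows "integrable M (\<lambda>\<omega>. (noise k x \<omega>)\<^sup>2) \<and> expectation (noise k x) = 0
    \<and> expectation (\<lambda>\<omega>. (noise k x \<omega>)\<^sup>2) \<le> real x + \<tau>"
proof (induction x)
  case 0
  have "noise k 0 = (\<lambda>\<omega>. real (eps k \<omega>) - \<mu>)" by (auto simp: noise_def offspring_def)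
  then show ?case using eps_moments[OF k] by simp
next
  case (Suc x)
  define A where "A = {EpsIdx k} \<union> {XiIdx k j | j. 1 \<le> j \<and> j \<le> x}"
  define B where "B = {XiIdx k (Suc x)}"
  have AB: "A \<inter> B = {}" "A \<subseteq> inar_index_set" "B \<subseteq> inar_index_set"
    using k by (auto simp: A_def B_def inar_index_set_def)
  define \<eta> where "\<eta> \<omega> = real (xi k (Suc x) \<omega>) - \<alpha>" for \<omega>
  have mA: "noise k x \<in> borel_measurable (info A)"
    by (rule measurable_info_noise) (auto simp: A_def)
  have mB: "\<eta> \<in> borel_measurable (info B)"
    unfolding \<eta>_def[abs_def] B_def
    by (intro borel_measurable_diff measurable_real_info measurable_info_vars) auto
  have \<eta>: "integrable M \<eta>" "integrable M (\<lambda>\<omega>. (\<eta> \<omega>)\<^sup>2)" "expectation \<eta> = 0"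
    "expectation (\<lambda>\<omega>. (\<eta> \<omega>)\<^sup>2) \<le> 1"
    using centered_xi[OF k, of "Suc x"] unfolding \<eta>_def[abs_def] by auto
  have N: "integrable M (noise k x)"
    using Suc measurable_from_info[OF AB(2) mA] by - (rule integrable_of_square, auto)
  have eq: "noise k (Suc x) = (\<lambda>\<omega>. noise k x \<omega> + \<eta> \<omega>)"
    by (auto simp: noise_def offspring_def \<eta>_def algebra_simps)
  have sq: "(noise k x \<omega> + \<eta> \<omega>)\<^sup>2 = (noise k x \<omega>)\<^sup>2 + 2 * (noise k x \<omega> * \<eta> \<omega>) + (\<eta> \<omega>)\<^sup>2" for \<omega>
    by (simp add: power2_sum)
  show ?case
    unfolding eq sq
    using expectation_mult_info[OF AB mA N mB \<eta>(1)] \<eta> N Suc by simp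
qed

text \<open>Halfway between \<alpha>^2 and 1: a contraction factor with room to absorb the term
  linear in the state.\<close>

definition \<rho> :: real where "\<rho> = (1 + \<alpha>\<^sup>2) / 2"

lemma \<rho>: "\<alpha>\<^sup>2 < \<rho>" "\<rho> < 1" "0 < \<rho>"
proof -
  have "\<alpha>\<^sup>2 < 1" using \<alpha> by (simp add: power_less_one_iff abs_square_less_1)
  then show "\<alpha>\<^sup>2 < \<rho>" "\<rho> < 1" unfolding \<rho>_def by auto
  show "0 < \<rho>" unfolding \<rho>_def by (simp add: add_pos_nonneg)
qed

text \<open>The fraction is the maximum over real x of (1 + 2\<mu>) x - (\<rho> - \<alpha>^2) x^2,
  obtained by completing the square.\<close>

definition drift :: real where "drift = \<tau> + \<mu>\<^sup>2 + (1 + 2 * \<mu>)\<^sup>2 / (4 * (\<rho> - \<alpha>\<^sup>2))"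

lemma drift_nonneg: "0 \<le> drift"
  unfolding drift_def using \<rho> \<tau>_nonneg by simp

lemma offspring_second_moment:
  assumes k: "1 \<le> k"
  shows "integrable M (\<lambda>\<omega>. (real (offspring k x \<omega>))\<^sup>2)"
    and "expectation (\<lambda>\<omega>. (real (offspring k x \<omega>))\<^sup>2) \<le> \<rho> * (real x)\<^sup>2 + drift"
proof -
  have m: "noise k x \<in> borel_measurable M"
    using k by (intro measurable_from_info[OF past_current(2)] measurable_info_noise) (auto simp: current_def)
  note N = noise_moments[OF k, of x]
  have I: "integrable M (noise k x)" using N m by - (rule integrable_of_square, auto)
  define c where "c = \<alpha> * real x + \<mu>"
  have eq: "(real (offspring k x \<omega>))\<^sup>2 = (noise k x \<omega>)\<^sup>2 + 2 * c * noise k x \<omega> + c\<^sup>2" for \<omega>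
    unfolding noise_def c_def by (simp add: power2_eq_square algebra_simps)
  show "integrable M (\<lambda>\<omega>. (real (offspring k x \<omega>))\<^sup>2)" unfolding eq using N I by simp
  have "expectation (\<lambda>\<omega>. (real (offspring k x \<omega>))\<^sup>2) = expectation (\<lambda>\<omega>. (noise k x \<omega>)\<^sup>2) + c\<^sup>2"
    unfolding eq using N I by (simp add: prob_space)
  also have "\<dots> \<le> real x + \<tau> + c\<^sup>2" using N by simp
  also have "\<dots> = \<alpha>\<^sup>2 * (real x)\<^sup>2 + (1 + 2 * \<alpha> * \<mu>) * real x + \<tau> + \<mu>\<^sup>2"
    unfolding c_def by (simp add: power2_eq_square algebra_simps)
  also have "\<dots> \<le> \<alpha>\<^sup>2 * (real x)\<^sup>2 + (1 + 2 * \<mu>) * real x + \<tau> + \<mu>\<^sup>2"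
    using \<alpha> \<mu>_pos by (intro add_mono mult_right_mono) (auto simp: mult_left_le_one_le)
  also have "\<dots> \<le> \<rho> * (real x)\<^sup>2 + drift"
  proof -
    define r where "r = \<rho> - \<alpha>\<^sup>2"
    have r: "0 < r" unfolding r_def using \<rho> by simp
    have "0 \<le> (2 * r * real x - (1 + 2 * \<mu>))\<^sup>2" by simp
    then have "4 * r * ((1 + 2 * \<mu>) * real x) \<le> 4 * r * (r * (real x)\<^sup>2) + (1 + 2 * \<mu>)\<^sup>2"
      by (simp add: power2_eq_square algebra_simps)
    then have "(1 + 2 * \<mu>) * real x \<le> r * (real x)\<^sup>2 + (1 + 2 * \<mu>)\<^sup>2 / (4 * r)"
      using r by (simp add: field_simps)
    then show ?thesis unfolding drift_def r_def by (simp add: algebra_simps)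
  qed
  finally show "expectation (\<lambda>\<omega>. (real (offspring k x \<omega>))\<^sup>2) \<le> \<rho> * (real x)\<^sup>2 + drift" .
qed

text \<open>Conditioning on the state by hand: split over the countably many values of
  \<open>X k\<close>, use independence of the event from the fresh randomness on each piece, and
  reassemble. Nonnegative integrals allow this before integrability at the random state is
  known.\<close>

lemma nn_integral_next_le:
  fixes h :: "nat \<Rightarrow> 'a \<Rightarrow> real" and \<phi> :: "nat \<Rightarrow> real"
  assumes h: "\<And>x. h x \<in> borel_measurable (info (current (Suc k)))" "\<And>x. integrable M (h x)"
      "\<And>x \<omega>. 0 \<le> h x \<omega>"
    and le: "\<And>x. expectation (h x) \<le> \<phi> x"
  shows "(\<integral>\<^sup>+\<omega>. ennreal (h (X k \<omega>) \<omega>) \<partial>M) \<le> (\<integral>\<^sup>+\<omega>. ennreal (\<phi> (X k \<omega>)) \<partial>M)"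
proof -
  have \<phi>: "0 \<le> \<phi> x" for x
    by (rule order_trans[OF integral_nonneg_AE le]) (use h(3) in auto)
  have [measurable]: "h x \<in> borel_measurable M" for x using h(2) by auto
  define I :: "nat \<Rightarrow> 'a \<Rightarrow> real" where "I x \<omega> = (if X k \<omega> = x then 1 else 0)" for x \<omega>
  have I0: "0 \<le> I x \<omega>" for x \<omega> unfolding I_def by simp
  have mI: "I x \<in> borel_measurable (info (past k))" for x
    unfolding I_def[abs_def]
    by (rule measurable_compose[OF measurable_info_X, of "\<lambda>n. if n = x then 1 else 0"]) simp
  have [measurable]: "I x \<in> borel_measurable M" for x
    by (rule measurable_from_info[OF past_current(1) mI])
  have iI: "integrable M (I x)" for x
    by (rule integrable_const_bound[of _ 1]) (auto simp: I_def)
  have single: "ennreal (f (X k \<omega>)) = (\<Sum>x. ennreal (I x \<omega> * f x))" for f :: "nat \<Rightarrow> real" and \<omega>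
    by (subst suminf_finite[of "{X k \<omega>}"]) (auto simp: I_def)
  have AB: "past k \<inter> current (Suc k) = {}" "past k \<subseteq> inar_index_set" "current (Suc k) \<subseteq> inar_index_set"
    using past_current by auto
  have "(\<integral>\<^sup>+\<omega>. ennreal (h (X k \<omega>) \<omega>) \<partial>M) = (\<Sum>x. \<integral>\<^sup>+\<omega>. ennreal (I x \<omega> * h x \<omega>) \<partial>M)"
    unfolding single[of "\<lambda>x. h x _"] by (rule nn_integral_suminf) simp
  also have "\<dots> \<le> (\<Sum>x. \<integral>\<^sup>+\<omega>. ennreal (I x \<omega> * \<phi> x) \<partial>M)"
  proof (rule suminf_le)
    fix x
    note E = expectation_mult_info[OF AB mI iI h(1,2), of x]
    have "(\<integral>\<^sup>+\<omega>. ennreal (I x \<omega> * h x \<omega>) \<partial>M) = ennreal (expectation (I x) * expectation (h x))"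
      using E I0 h(3) by (subst nn_integral_eq_integral) auto
    also have "\<dots> \<le> ennreal (expectation (I x) * \<phi> x)"
      using le[of x] I0 by (intro ennreal_leI mult_left_mono integral_nonneg_AE) auto
    also have "\<dots> = (\<integral>\<^sup>+\<omega>. ennreal (I x \<omega> * \<phi> x) \<partial>M)"
      using iI I0 \<phi> by (subst nn_integral_eq_integral) auto
    finally show "(\<integral>\<^sup>+\<omega>. ennreal (I x \<omega> * h x \<omega>) \<partial>M) \<le> (\<integral>\<^sup>+\<omega>. ennreal (I x \<omega> * \<phi> x) \<partial>M)" .
  qed auto
  also have "\<dots> = (\<integral>\<^sup>+\<omega>. ennreal (\<phi> (X k \<omega>)) \<partial>M)"
    unfolding single[of \<phi>] by (rule nn_integral_suminf[symmetric]) simp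
  finally show ?thesis .
qed

text \<open>The number drift/(1 - \<rho>) is the fixed point of b -> \<rho> b + drift, and larger
  numbers are mapped below themselves; the summand from \<open>X0\<close> starts the
  induction.\<close>

definition second_moment_bound :: real where
  "second_moment_bound = expectation (\<lambda>\<omega>. (real (X0 \<omega>))\<^sup>2) + drift / (1 - \<rho>)"

lemma X_second_moment:
  "integrable M (\<lambda>\<omega>. (real (X k \<omega>))\<^sup>2) \<and> expectation (\<lambda>\<omega>. (real (X k \<omega>))\<^sup>2) \<le> second_moment_bound"
proof (induction k)
  case 0
  then show ?case
    using X0_square drift_nonneg \<rho> unfolding second_moment_bound_def by simp
next
  case (Suc k)
  let ?B = second_moment_bound
  have I: "integrable M (\<lambda>\<omega>. \<rho> * (real (X k \<omega>))\<^sup>2 + drift)" using Suc by simp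
  have B: "\<rho> * ?B + drift \<le> ?B"
  proof -
    have "0 \<le> expectation (\<lambda>\<omega>. (real (X0 \<omega>))\<^sup>2)" by simp
    then have "drift / (1 - \<rho>) \<le> ?B" unfolding second_moment_bound_def by linarith
    then show ?thesis using \<rho> by (simp add: divide_le_eq algebra_simps)
  qed
  have "(\<integral>\<^sup>+\<omega>. ennreal ((real (X (Suc k) \<omega>))\<^sup>2) \<partial>M) \<le> (\<integral>\<^sup>+\<omega>. ennreal (\<rho> * (real (X k \<omega>))\<^sup>2 + drift) \<partial>M)"
    unfolding X_Suc
    by (rule nn_integral_next_le[of "\<lambda>x \<omega>. (real (offspring (Suc k) x \<omega>))\<^sup>2"])
       (auto intro!: borel_measurable_power measurable_real_info measurable_info_offspring
          offspring_second_moment simp: current_def)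
  also have "\<dots> = ennreal (expectation (\<lambda>\<omega>. \<rho> * (real (X k \<omega>))\<^sup>2 + drift))"
    using I \<rho> drift_nonneg by (intro nn_integral_eq_integral) auto
  also have "\<dots> \<le> ennreal ?B"
  proof (rule ennreal_leI)
    have "\<rho> * expectation (\<lambda>\<omega>. (real (X k \<omega>))\<^sup>2) \<le> \<rho> * ?B"
      using Suc \<rho> by (intro mult_left_mono) auto
    then show "expectation (\<lambda>\<omega>. \<rho> * (real (X k \<omega>))\<^sup>2 + drift) \<le> ?B"
      using Suc B by (simp add: prob_space)
  qed
  finally have le: "(\<integral>\<^sup>+\<omega>. ennreal ((real (X (Suc k) \<omega>))\<^sup>2) \<partial>M) \<le> ennreal ?B" .
  have int: "integrable M (\<lambda>\<omega>. (real (X (Suc k) \<omega>))\<^sup>2)"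
    using le by (intro integrableI_nonneg) (auto simp del: inar_X.simps intro: le_less_trans)
  have "0 \<le> ?B" unfolding second_moment_bound_def using drift_nonneg \<rho> by simp
  then have "expectation (\<lambda>\<omega>. (real (X (Suc k) \<omega>))\<^sup>2) \<le> ?B"
    using le unfolding nn_integral_eq_integral[OF int AE_I2[OF zero_le_power2]] by simp
  with int show ?case by blast
qed

lemma second_moment_bound_nonneg: "0 \<le> second_moment_bound"
  unfolding second_moment_bound_def using drift_nonneg \<rho> by simp

lemma shifted_X_second_moment:
  "integrable M (\<lambda>\<omega>. (1 + real (X k \<omega>))\<^sup>2)"
  "expectation (\<lambda>\<omega>. (1 + real (X k \<omega>))\<^sup>2) \<le> 2 + 2 * second_moment_bound"
proof -
  note X = X_second_moment[of k]
  have m: "(\<lambda>\<omega>. real (X k \<omega>)) \<in> borel_measurable M"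
    by (rule measurable_real_info[OF X_measurable])
  have I: "integrable M (\<lambda>\<omega>. real (X k \<omega>))"
    by (rule integrable_of_square[OF m]) (use X in blast)
  have eq: "(1 + real (X k \<omega>))\<^sup>2 = 1 + 2 * real (X k \<omega>) + (real (X k \<omega>))\<^sup>2" for \<omega>
    by (simp add: power2_sum)
  show int: "integrable M (\<lambda>\<omega>. (1 + real (X k \<omega>))\<^sup>2)"
    unfolding eq using X I by simp
  have "expectation (\<lambda>\<omega>. (1 + real (X k \<omega>))\<^sup>2) \<le> expectation (\<lambda>\<omega>. 2 + 2 * (real (X k \<omega>))\<^sup>2)"
  proof (rule integral_mono[OF int])
    show "integrable M (\<lambda>\<omega>. 2 + 2 * (real (X k \<omega>))\<^sup>2)" using X by simp
    fix \<omega>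
    have "0 \<le> (1 - real (X k \<omega>))\<^sup>2" by simp
    then show "(1 + real (X k \<omega>))\<^sup>2 \<le> 2 + 2 * (real (X k \<omega>))\<^sup>2"
      by (simp add: power2_eq_square algebra_simps)
  qed
  also have "\<dots> \<le> 2 + 2 * second_moment_bound" using X by (simp add: prob_space)
  finally show "expectation (\<lambda>\<omega>. (1 + real (X k \<omega>))\<^sup>2) \<le> 2 + 2 * second_moment_bound" .
qed

section \<open>Strong laws along the chain\<close>

lemma AE_X_growth:
  "AE \<omega> in M. \<forall>\<^sub>F k in sequentially. 1 + real (X k \<omega>) \<le> (1 + real k) powr (3/4)"
proof -
  \<comment> \<open>The weight is the inverse square of the truncation level, so \<open>f k\<close>
    below 1 means exactly that 1 + X k lies below that level.\<close>
  define f where "f k \<omega> = (1 + real k) powr (- (3/2)) * (1 + real (X k \<omega>))\<^sup>2" for k \<omega>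
  have "AE \<omega> in M. (\<lambda>k. f k \<omega>) \<longlonglongrightarrow> 0"
  proof (rule AE_tendsto_zero_of_summable_expectation)
    show "integrable M (f k)" for k unfolding f_def[abs_def] using shifted_X_second_moment(1) by simp
    show "0 \<le> f k \<omega>" for k \<omega> unfolding f_def by simp
    have E: "0 \<le> expectation (f k)" "expectation (f k) \<le> (1 + real k) powr (- (3/2)) * (2 + 2 * second_moment_bound)" for k
      unfolding f_def[abs_def] using shifted_X_second_moment[of k] by (auto intro: mult_left_mono)
    have "summable (\<lambda>k. real k powr (- (3/2)))" by (simp add: summable_real_powr_iff)
    then have "summable (\<lambda>k. real (Suc k) powr (- (3/2)))" by (subst summable_Suc_iff)
    then have "summable (\<lambda>k. (1 + real k) powr (- (3/2)) * (2 + 2 * second_moment_bound))"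
      by (intro summable_mult2) (simp add: add_ac)
    then show "summable (\<lambda>k. expectation (f k))"
      by (rule summable_comparison_test'[where N=0]) (use E in auto)
  qed
  then show ?thesis
  proof eventually_elim
    case (elim \<omega>)
    then have "\<forall>\<^sub>F k in sequentially. f k \<omega> < 1" by (rule order_tendstoD) simp
    then show ?case
    proof eventually_elim
      case (elim k)
      define b where "b = (1 + real k) powr (3/4)"
      have b: "0 < b" unfolding b_def by simp
      have "(1 + real k) powr (- (3/2)) = 1 / b\<^sup>2"
      proof -
        have "b * b = (1 + real k) powr (3/4 + 3/4)"
          unfolding b_def by (rule powr_add[symmetric])
        also have "3/4 + 3/4 = (3/2 :: real)" by simp
        finally show ?thesis by (simp only: powr_minus_divide power2_eq_square)
      qed
      then have "(1 + real (X k \<omega>))\<^sup>2 < b\<^sup>2" using elim b unfolding f_def by (simp add: divide_less_eq)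
      then have "1 + real (X k \<omega>) < b" by (rule power2_less_imp_less) (use b in simp)
      then show ?case unfolding b_def by simp
    qed
  qed
qed

text \<open>Here $V_{k,x}$ is the noise of the step from time $k$ to $k + 1$ when the chain is in state $x$; truncating
  $1 + X_k$ at $(1 + k)^{3/4}$ costs one power of the chain against a variance of cubic growth.\<close>
theorem chain_strong_law:
  fixes V :: "nat \<Rightarrow> nat \<Rightarrow> 'a \<Rightarrow> real"
  assumes V: "\<And>k x. V k x \<in> borel_measurable (info (current (Suc k)))"
      "\<And>k x. integrable M (\<lambda>\<omega>. (V k x \<omega>)\<^sup>2)"
      "\<And>k x. expectation (V k x) = 0"
      "\<And>k x. expectation (\<lambda>\<omega>. (V k x \<omega>)\<^sup>2) \<le> C * (1 + real x) ^ 3"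
    and C: "0 \<le> C"
  shows "AE \<omega> in M. (\<lambda>n. (\<Sum>k<n. V k (X k \<omega>) \<omega>) / real n) \<longlonglongrightarrow> 0"
proof -
  define b where "b k = (1 + real k) powr (3/4)" for k
  define W where "W k x \<omega> = (if 1 + real x \<le> b k then V k x \<omega> else 0)" for k x \<omega>
  define T where "T k \<omega> = W k (X k \<omega>) \<omega>" for k \<omega>
  define C' where "C' = C * (2 + 2 * second_moment_bound)"
  have AB: "past k \<inter> current (Suc k) = {}" "past k \<subseteq> inar_index_set" "current (Suc k) \<subseteq> inar_index_set" for k
    using past_current by auto
  have W: "W k x \<in> borel_measurable (info (current (Suc k)))" "integrable M (\<lambda>\<omega>. (W k x \<omega>)\<^sup>2)"
      "expectation (W k x) = 0" "integrable M (W k x)" for k x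
  proof -
    show m: "W k x \<in> borel_measurable (info (current (Suc k)))"
      unfolding W_def[abs_def] using V(1) by simp
    show sq: "integrable M (\<lambda>\<omega>. (W k x \<omega>)\<^sup>2)"
      using V(2)[of k x] by (cases "1 + real x \<le> b k") (simp_all add: W_def)
    show "expectation (W k x) = 0" using V(3)[of k x] by (cases "1 + real x \<le> b k") (simp_all add: W_def[abs_def])
    show "integrable M (W k x)"
      by (rule integrable_of_square[OF measurable_from_info[OF AB(3) m] sq])
  qed
  have W_sq: "expectation (\<lambda>\<omega>. (W k x \<omega>)\<^sup>2) \<le> (C * b k) * (1 + real x)\<^sup>2" for k x
  proof (cases "1 + real x \<le> b k")
    case True
    have "expectation (\<lambda>\<omega>. (W k x \<omega>)\<^sup>2) \<le> C * ((1 + real x) * (1 + real x)\<^sup>2)"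
      using V(4)[of k x] True unfolding W_def by (simp add: power3_eq_cube power2_eq_square mult_ac)
    also have "\<dots> \<le> C * (b k * (1 + real x)\<^sup>2)"
      using C True by (intro mult_left_mono mult_right_mono) auto
    finally show ?thesis by (simp add: mult_ac)
  next
    case False
    then show ?thesis using C unfolding W_def b_def by simp
  qed
  have Tm: "T k \<in> borel_measurable (info (past (Suc k)))" for k
    unfolding T_def[abs_def]
  proof (rule measurable_compose_countable)
    show "W k x \<in> borel_measurable (info (past (Suc k)))" for x
      by (rule measurable_info_mono[OF past_current(4) W(1)])
    show "X k \<in> measurable (info (past (Suc k))) (count_space UNIV)"
      by (rule measurable_info_mono[OF past_current(5) measurable_info_X]) simp
  qed
  have TM: "T k \<in> borel_measurable M" for k
    by (rule measurable_from_info[OF past_current(1) Tm])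
  have le: "(\<integral>\<^sup>+\<omega>. ennreal ((T k \<omega>)\<^sup>2) \<partial>M) \<le> ennreal (C' * b k)" for k
  proof -
    have "(\<integral>\<^sup>+\<omega>. ennreal ((T k \<omega>)\<^sup>2) \<partial>M) \<le> (\<integral>\<^sup>+\<omega>. ennreal ((C * b k) * (1 + real (X k \<omega>))\<^sup>2) \<partial>M)"
      unfolding T_def
      by (rule nn_integral_next_le[of "\<lambda>x \<omega>. (W k x \<omega>)\<^sup>2"]) (use W W_sq in auto)
    also have "\<dots> = ennreal (expectation (\<lambda>\<omega>. (C * b k) * (1 + real (X k \<omega>))\<^sup>2))"
      using shifted_X_second_moment(1) C by (intro nn_integral_eq_integral) (auto simp: b_def)
    also have "\<dots> \<le> ennreal (C' * b k)"
    proof (rule ennreal_leI)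
      have "(C * b k) * expectation (\<lambda>\<omega>. (1 + real (X k \<omega>))\<^sup>2) \<le> (C * b k) * (2 + 2 * second_moment_bound)"
        using C shifted_X_second_moment(2) by (intro mult_left_mono) (auto simp: b_def)
      then show "expectation (\<lambda>\<omega>. (C * b k) * (1 + real (X k \<omega>))\<^sup>2) \<le> C' * b k"
        unfolding C'_def by (simp add: mult_ac)
    qed
    finally show ?thesis .
  qed
  have Tsq: "integrable M (\<lambda>\<omega>. (T k \<omega>)\<^sup>2)" for k
    using le[of k] TM[of k] by (intro integrableI_nonneg) (auto intro: le_less_trans)
  have Tle: "expectation (\<lambda>\<omega>. (T k \<omega>)\<^sup>2) \<le> C' * (1 + real k) powr (3/4)" for k
  proof -
    have "0 \<le> C' * b k" unfolding C'_def b_def using C second_moment_bound_nonneg by simp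
    then show ?thesis
      using le[of k] unfolding nn_integral_eq_integral[OF Tsq AE_I2[OF zero_le_power2]] b_def by simp
  qed
  have orth: "expectation (\<lambda>\<omega>. T i \<omega> * T k \<omega>) = 0" if "i < k" for i k
  proof -
    \<comment> \<open>Above \<open>N\<close> the truncated term is zero, so splitting over the value
      of \<open>X k\<close> gives a finite sum. The earlier term \<open>T i\<close> joins the event
      of \<open>X k\<close> in the past, as i < k, leaving a centered independent factor
      \<open>W k x\<close>.\<close>
    define N where "N = nat \<lceil>b k\<rceil>"
    define U where "U x \<omega> = T i \<omega> * (if X k \<omega> = x then 1 else 0)" for x \<omega>
    have mI: "(\<lambda>\<omega>. if X k \<omega> = x then 1 else 0 :: real) \<in> borel_measurable (info (past k))" for x
      by (rule measurable_compose[OF measurable_info_X, of "\<lambda>n. if n = x then 1 else 0"]) simp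
    have U: "U x \<in> borel_measurable (info (past k))" for x
      unfolding U_def[abs_def]
      by (intro borel_measurable_times mI measurable_info_mono[OF past_current(5) Tm]) (use that in simp)
    have iU: "integrable M (U x)" for x
    proof (rule Bochner_Integration.integrable_bound)
      show "integrable M (T i)" by (rule integrable_of_square[OF TM Tsq])
      show "U x \<in> borel_measurable M" by (rule measurable_from_info[OF past_current(1) U])
    qed (auto simp: U_def)
    have eq: "T i \<omega> * T k \<omega> = (\<Sum>x\<le>N. U x \<omega> * W k x \<omega>)" for \<omega>
    proof -
      have "(\<Sum>x\<le>N. U x \<omega> * W k x \<omega>) = (\<Sum>x\<le>N. if x = X k \<omega> then T i \<omega> * W k x \<omega> else 0)"
        by (intro sum.cong) (auto simp: U_def)
      also have "\<dots> = (if X k \<omega> \<le> N then T i \<omega> * W k (X k \<omega>) \<omega> else 0)" by simp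
      also have "\<dots> = T i \<omega> * T k \<omega>"
      proof (cases "X k \<omega> \<le> N")
        case False
        then have "b k < real (X k \<omega>)" unfolding N_def by linarith
        then show ?thesis using False by (simp add: T_def W_def)
      qed (simp add: T_def)
      finally show ?thesis by simp
    qed
    have UW: "integrable M (\<lambda>\<omega>. U x \<omega> * W k x \<omega>)" "expectation (\<lambda>\<omega>. U x \<omega> * W k x \<omega>) = 0" for x
      using expectation_mult_info[OF AB U iU W(1,4), of x x] W(3) by auto
    show ?thesis unfolding eq using UW by simp
  qed
  have "AE \<omega> in M. (\<lambda>n. (\<Sum>k<n. T k \<omega>) / real n) \<longlonglongrightarrow> 0"
    by (rule orthogonal_strong_law[OF TM Tsq orth Tle])
  with AE_X_growth show ?thesis
  proof eventually_elim
    case (elim \<omega>)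
    obtain K where K: "\<And>k. K \<le> k \<Longrightarrow> 1 + real (X k \<omega>) \<le> b k"
      using elim(1) unfolding eventually_sequentially b_def by blast
    define c where "c = (\<Sum>k<K. V k (X k \<omega>) \<omega> - T k \<omega>)"
    have "(\<Sum>k<n. V k (X k \<omega>) \<omega>) / real n = (\<Sum>k<n. T k \<omega>) / real n + c / real n" if "K \<le> n" for n
    proof -
      have "(\<Sum>k<n. V k (X k \<omega>) \<omega> - T k \<omega>) = c"
        unfolding c_def using that K
        by (intro sum.mono_neutral_right) (auto simp: T_def W_def not_less)
      then show ?thesis by (simp add: sum_subtractf add_divide_distrib[symmetric])
    qed
    then have "\<forall>\<^sub>F n in sequentially. (\<Sum>k<n. T k \<omega>) / real n + c / real n = (\<Sum>k<n. V k (X k \<omega>) \<omega>) / real n"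
      by (intro eventually_sequentiallyI[of K]) simp
    moreover have "(\<lambda>n. (\<Sum>k<n. T k \<omega>) / real n + c / real n) \<longlonglongrightarrow> 0 + 0"
      by (intro tendsto_add elim(2) lim_const_over_n)
    ultimately show ?case by (auto intro: Lim_transform_eventually)
  qed
qed

text \<open>The errors in the two normal equations of least squares. Weighting the noise by the
  state raises its variance bound from linear to cubic, which is the growth that
  \<open>chain_strong_law\<close> admits.\<close>

lemma AE_noise_averages:
  "AE \<omega> in M. (\<lambda>n. (\<Sum>k<n. real (X (Suc k) \<omega>) - \<alpha> * real (X k \<omega>) - \<mu>) / real n) \<longlonglongrightarrow> 0"
  "AE \<omega> in M. (\<lambda>n. (\<Sum>k<n. (real (X (Suc k) \<omega>) - \<alpha> * real (X k \<omega>) - \<mu>) * real (X k \<omega>)) / real n) \<longlonglongrightarrow> 0"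
proof -
  have m: "noise (Suc k) x \<in> borel_measurable (info (current (Suc k)))" for k x
    by (rule measurable_info_noise) (auto simp: current_def)
  have N: "integrable M (\<lambda>\<omega>. (noise (Suc k) x \<omega>)\<^sup>2)" "expectation (noise (Suc k) x) = 0"
      "expectation (\<lambda>\<omega>. (noise (Suc k) x \<omega>)\<^sup>2) \<le> (1 + \<tau>) * (1 + real x)" for k x
  proof -
    note N = noise_moments[of "Suc k" x, simplified]
    show "integrable M (\<lambda>\<omega>. (noise (Suc k) x \<omega>)\<^sup>2)" "expectation (noise (Suc k) x) = 0"
      using N by auto
    have "0 \<le> \<tau> * real x" using \<tau>_nonneg by simp
    then have "real x + \<tau> \<le> (1 + \<tau>) * (1 + real x)" by (simp add: algebra_simps)
    with N show "expectation (\<lambda>\<omega>. (noise (Suc k) x \<omega>)\<^sup>2) \<le> (1 + \<tau>) * (1 + real x)" by linarith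
  qed
  have T: "0 \<le> 1 + \<tau>" using \<tau>_nonneg by simp
  have step: "real (X (Suc k) \<omega>) - \<alpha> * real (X k \<omega>) - \<mu> = noise (Suc k) (X k \<omega>) \<omega>" for k \<omega>
    unfolding X_Suc noise_def ..
  show "AE \<omega> in M. (\<lambda>n. (\<Sum>k<n. real (X (Suc k) \<omega>) - \<alpha> * real (X k \<omega>) - \<mu>) / real n) \<longlonglongrightarrow> 0"
    unfolding step
  proof (rule chain_strong_law[OF m N(1,2) _ T])
    fix k x
    have "(1 + real x) ^ 1 \<le> (1 + real x) ^ 3" by (rule power_increasing) auto
    then have "(1 + \<tau>) * (1 + real x) \<le> (1 + \<tau>) * (1 + real x) ^ 3"
      using T by (intro mult_left_mono) auto
    with N(3) show "expectation (\<lambda>\<omega>. (noise (Suc k) x \<omega>)\<^sup>2) \<le> (1 + \<tau>) * (1 + real x) ^ 3"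
      by (rule order_trans)
  qed
  show "AE \<omega> in M. (\<lambda>n. (\<Sum>k<n. (real (X (Suc k) \<omega>) - \<alpha> * real (X k \<omega>) - \<mu>) * real (X k \<omega>)) / real n) \<longlonglongrightarrow> 0"
    unfolding step
  proof (rule chain_strong_law[of "\<lambda>k x \<omega>. noise (Suc k) x \<omega> * real x", OF _ _ _ _ T])
    fix k x
    show "(\<lambda>\<omega>. noise (Suc k) x \<omega> * real x) \<in> borel_measurable (info (current (Suc k)))"
      using m by simp
    show "integrable M (\<lambda>\<omega>. (noise (Suc k) x \<omega> * real x)\<^sup>2)"
      using N(1) by (simp add: power_mult_distrib)
    show "expectation (\<lambda>\<omega>. noise (Suc k) x \<omega> * real x) = 0" using N(2) by simp
    have "expectation (\<lambda>\<omega>. (noise (Suc k) x \<omega> * real x)\<^sup>2)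
        = expectation (\<lambda>\<omega>. (noise (Suc k) x \<omega>)\<^sup>2) * (real x)\<^sup>2"
      by (simp add: power_mult_distrib)
    also have "\<dots> \<le> ((1 + \<tau>) * (1 + real x)) * (1 + real x)\<^sup>2"
      using N(3) T by (intro mult_mono power_mono) auto
    finally show "expectation (\<lambda>\<omega>. (noise (Suc k) x \<omega> * real x)\<^sup>2) \<le> (1 + \<tau>) * (1 + real x) ^ 3"
      by (simp add: power3_eq_cube power2_eq_square mult_ac)
  qed
qed

section \<open>Nondegeneracy of the sample variance\<close>

lemma prob_offspring_ne:
  assumes k: "1 \<le> k" and x: "1 \<le> x"
  shows "min \<alpha> (1 - \<alpha>) \<le> prob {\<omega> \<in> space M. offspring k x \<omega> \<noteq> x}"
proof -
  define A where "A = {EpsIdx k} \<union> {XiIdx k j | j. 2 \<le> j}"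
  define B where "B = {XiIdx k 1}"
  have AB: "A \<inter> B = {}" "A \<subseteq> inar_index_set" "B \<subseteq> inar_index_set"
    using k by (auto simp: A_def B_def inar_index_set_def)
  define R where "R \<omega> = (\<Sum>j\<in>{2..x}. xi k j \<omega>) + eps k \<omega>" for \<omega>
  have off: "offspring k x \<omega> = xi k 1 \<omega> + R \<omega>" for \<omega>
  proof -
    have "{1..x} = insert 1 {2..x}" using x by auto
    then show ?thesis unfolding offspring_def R_def by simp
  qed
  have [measurable]: "eps k \<in> measurable (info A) (count_space UNIV)"
    by (rule measurable_info_vars(2)) (simp add: A_def)
  have [measurable]: "(\<lambda>\<omega>. \<Sum>j\<in>{2..x}. xi k j \<omega>) \<in> measurable (info A) (count_space UNIV)"
    by (intro measurable_sum_nat measurable_info_vars) (auto simp: A_def)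
  have mR: "R \<in> measurable (info A) (count_space UNIV)"
    unfolding R_def[abs_def] by measurable
  have mX: "xi k 1 \<in> measurable (info B) (count_space UNIV)"
    by (rule measurable_info_vars) (simp add: B_def)
  note [measurable] = measurable_from_info[OF AB(2) mR] measurable_from_info[OF AB(3) mX]
  define p where "p v = prob {\<omega> \<in> space M. R \<omega> = v}" for v
  have prod: "prob {\<omega> \<in> space M. R \<omega> = v \<and> xi k 1 \<omega> = w} = p v * prob {\<omega> \<in> space M. xi k 1 \<omega> = w}" for v w
  proof -
    have "{\<omega> \<in> space M. R \<omega> = v \<and> xi k 1 \<omega> = w} = (\<lambda>\<omega>. (R \<omega>, xi k 1 \<omega>)) -` ({v} \<times> {w}) \<inter> space M"
      "{\<omega> \<in> space M. R \<omega> = v} = R -` {v} \<inter> space M" "{\<omega> \<in> space M. xi k 1 \<omega> = w} = xi k 1 -` {w} \<inter> space M"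
      by auto
    then show ?thesis
      unfolding p_def using indep_varD[OF indep_var_info[OF AB mR mX], of "{v}" "{w}"] by simp
  qed
  \<comment> \<open>To stay at \<open>x\<close>, the first Bernoulli variable must fill exactly the
    gap left by the rest \<open>R\<close>, so each value of \<open>R\<close> admits only one
    outcome, of probability at most max \<alpha> (1 - \<alpha>). The two values of \<open>R\<close>
    are distinct since x is positive.\<close>
  have "prob {\<omega> \<in> space M. offspring k x \<omega> = x} \<le>
      prob ({\<omega> \<in> space M. R \<omega> = x \<and> xi k 1 \<omega> = 0} \<union> {\<omega> \<in> space M. R \<omega> = x - 1 \<and> xi k 1 \<omega> = 1})"
  proof (rule finite_measure_mono_AE)
    show "AE \<omega> in M. \<omega> \<in> {\<omega> \<in> space M. offspring k x \<omega> = x} \<longrightarrow>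
        \<omega> \<in> {\<omega> \<in> space M. R \<omega> = x \<and> xi k 1 \<omega> = 0} \<union> {\<omega> \<in> space M. R \<omega> = x - 1 \<and> xi k 1 \<omega> = 1}"
      using AE_xi(1)[OF k order_refl] by eventually_elim (auto simp: off)
  qed measurable
  also have "\<dots> \<le> prob {\<omega> \<in> space M. R \<omega> = x \<and> xi k 1 \<omega> = 0} + prob {\<omega> \<in> space M. R \<omega> = x - 1 \<and> xi k 1 \<omega> = 1}"
    by (rule measure_Un_le) measurable
  also have "\<dots> = p x * (1 - \<alpha>) + p (x - 1) * \<alpha>"
    unfolding prod using AE_xi(2,3)[OF k order_refl] by simp
  also have "\<dots> \<le> p x * max \<alpha> (1 - \<alpha>) + p (x - 1) * max \<alpha> (1 - \<alpha>)"
    by (intro add_mono mult_left_mono) (auto simp: p_def)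
  also have "\<dots> = (p x + p (x - 1)) * max \<alpha> (1 - \<alpha>)" by (simp add: distrib_right)
  also have "\<dots> \<le> 1 * max \<alpha> (1 - \<alpha>)"
  proof (rule mult_right_mono)
    have "p x + p (x - 1) = prob ({\<omega> \<in> space M. R \<omega> = x} \<union> {\<omega> \<in> space M. R \<omega> = x - 1})"
      unfolding p_def using x by (intro finite_measure_Union[symmetric]) auto
    then show "p x + p (x - 1) \<le> 1" by simp
  qed (use \<alpha> in auto)
  finally have *: "prob {\<omega> \<in> space M. offspring k x \<omega> = x} \<le> max \<alpha> (1 - \<alpha>)" by simp
  have "prob {\<omega> \<in> space M. offspring k x \<omega> \<noteq> x} = 1 - prob {\<omega> \<in> space M. offspring k x \<omega> = x}"
  proof -
    have "{\<omega> \<in> space M. offspring k x \<omega> = x} \<in> events"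
      unfolding off by measurable
    moreover have "{\<omega> \<in> space M. offspring k x \<omega> \<noteq> x} = space M - {\<omega> \<in> space M. offspring k x \<omega> = x}"
      by auto
    ultimately show ?thesis by (simp only: prob_compl)
  qed
  with * show ?thesis by (simp add: min_def max_def split: if_splits)
qed

text \<open>Each visit to \<open>x\<close> is followed by a departure with probability at least c0,
  whatever the past, and each departure leads to a time spent elsewhere. The strong law turns this
  into a positive frequency of times away from \<open>x\<close>.\<close>

lemma AE_leaves_state:
  assumes x: "1 \<le> x"
  shows "AE \<omega> in M. \<forall>\<^sub>F n in sequentially.
     min \<alpha> (1 - \<alpha>) / 4 * real n \<le> real (card {k. k < n \<and> X k \<omega> \<noteq> x})"
proof -
  define c where "c k = prob {\<omega> \<in> space M. offspring (Suc k) x \<omega> \<noteq> x}" for k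
  define c0 where "c0 = min \<alpha> (1 - \<alpha>)"
  have c0: "0 < c0" "c0 < 1" "c0 \<le> c k" for k
    using \<alpha> prob_offspring_ne[of "Suc k" x] x unfolding c_def c0_def by auto
  \<comment> \<open>The centered departure indicator, switched off in all other states. It is
    bounded by 1, so the variance hypothesis holds with C = 1.\<close>
  define V where "V k v \<omega> = (if v = x then (if offspring (Suc k) x \<omega> \<noteq> x then 1 else 0) - c k else 0)" for k v \<omega>
  have mS: "offspring (Suc k) x \<in> measurable (info (current (Suc k))) (count_space UNIV)" for k
    by (rule measurable_info_offspring) (auto simp: current_def)
  have mV: "V k v \<in> borel_measurable (info (current (Suc k)))" for k v
    unfolding V_def[abs_def]
    by (rule measurable_compose[OF mS, of "\<lambda>n. if v = x then (if n \<noteq> x then 1 else 0) - c k else 0"]) simp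
  have MV[measurable]: "V k v \<in> borel_measurable M" for k v
    by (rule measurable_from_info[OF past_current(2) mV]) simp
  have MS[measurable]: "offspring (Suc k) x \<in> measurable M (count_space UNIV)" for k
    by (rule measurable_from_info[OF past_current(2) mS]) simp
  have V1: "\<bar>V k v \<omega>\<bar> \<le> 1" for k v \<omega>
  proof -
    have "0 \<le> c k" "c k \<le> 1" unfolding c_def by auto
    then show ?thesis unfolding V_def by auto
  qed
  then have V2: "(V k v \<omega>)\<^sup>2 \<le> 1" for k v \<omega> by (simp add: abs_square_le_1)
  have "AE \<omega> in M. (\<lambda>n. (\<Sum>k<n. V k (X k \<omega>) \<omega>) / real n) \<longlonglongrightarrow> 0"
  proof (rule chain_strong_law[where C=1, OF mV])
    fix k v
    show int: "integrable M (\<lambda>\<omega>. (V k v \<omega>)\<^sup>2)"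
      by (rule integrable_const_bound[of _ 1]) (use V2 in auto)
    have "expectation (\<lambda>\<omega>. (V k v \<omega>)\<^sup>2) \<le> expectation (\<lambda>_. 1)"
      by (rule integral_mono[OF int]) (use V2 in auto)
    also have "\<dots> \<le> 1 * (1 + real v) ^ 3" by (simp add: prob_space)
    finally show "expectation (\<lambda>\<omega>. (V k v \<omega>)\<^sup>2) \<le> 1 * (1 + real v) ^ 3" .
    show "expectation (V k v) = 0"
    proof (cases "v = x")
      case True
      let ?S = "{\<omega> \<in> space M. offspring (Suc k) x \<omega> \<noteq> x}"
      have "expectation (V k v) = expectation (\<lambda>\<omega>. indicator ?S \<omega> - c k)"
        using True by (intro Bochner_Integration.integral_cong) (auto simp: V_def)
      also have "\<dots> = 0"
        using integrable_event[of ?S]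
        by (subst Bochner_Integration.integral_diff) (auto simp: prob_space c_def)
      finally show ?thesis .
    qed (simp add: V_def[abs_def])
  qed simp
  then show ?thesis
  proof eventually_elim
    case (elim \<omega>)
    have "0 < c0 / 4" using c0 by simp
    from tendstoD[OF elim this]
    have "\<forall>\<^sub>F n in sequentially. \<bar>(\<Sum>k<n. V k (X k \<omega>) \<omega>) / real n\<bar> < c0 / 4"
      by (simp only: dist_real_def diff_0_right)
    moreover have "\<forall>\<^sub>F n in sequentially. 4 / c0 < real n"
      using filterlim_real_sequentially by (simp add: filterlim_at_top_dense)
    ultimately show ?case
    proof eventually_elim
      case (elim n)
      have n: "0 < real n" using elim(2) c0(1) by (smt (verit) divide_pos_pos)
      let ?N = "\<lambda>k. if X k \<omega> \<noteq> x then 1 else 0 :: real"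
      have f: "real (card {k. k < n \<and> X k \<omega> \<noteq> x}) = (\<Sum>k<n. ?N k)"
      proof -
        have "{k. k < n \<and> X k \<omega> \<noteq> x} = {k \<in> {..<n}. X k \<omega> \<noteq> x}" by auto
        then show ?thesis by (simp add: sum.If_cases Int_def)
      qed
      have "(\<Sum>k<n. V k (X k \<omega>) \<omega>) \<le> (\<Sum>k<n. ?N (Suc k) - c0 * (1 - ?N k))"
      proof (rule sum_mono)
        fix k
        show "V k (X k \<omega>) \<omega> \<le> ?N (Suc k) - c0 * (1 - ?N k)"
          unfolding V_def X_Suc using c0(3)[of k] by auto
      qed
      also have "\<dots> = (\<Sum>k<n. ?N (Suc k)) - c0 * (real n - (\<Sum>k<n. ?N k))"
        by (simp add: sum_subtractf sum_distrib_left[symmetric])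
      also have "(\<Sum>k<n. ?N (Suc k)) \<le> (\<Sum>k<n. ?N k) + 1"
      proof -
        have "(\<Sum>k<n. ?N (Suc k)) = (\<Sum>k<n. ?N k) + ?N n - ?N 0"
          using sum.lessThan_Suc_shift[of ?N n] by (simp del: inar_X.simps)
        then show ?thesis by (simp split: if_splits)
      qed
      finally have "(\<Sum>k<n. V k (X k \<omega>) \<omega>) \<le> (\<Sum>k<n. ?N k) + 1 - c0 * (real n - (\<Sum>k<n. ?N k))"
        by simp
      moreover have "- (c0 / 4 * real n) < (\<Sum>k<n. V k (X k \<omega>) \<omega>)"
        using elim(1) n by (simp add: abs_less_iff field_simps)
      moreover have "4 < c0 * real n" using elim(2) c0(1) by (simp add: divide_less_eq mult.commute)
      moreover have "c0 * (\<Sum>k<n. ?N k) \<le> (\<Sum>k<n. ?N k)"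
        using c0 by (intro mult_left_le_one_le sum_nonneg) auto
      \<comment> \<open>With A the time away from \<open>x\<close>, the expected departures c0 (n -
        A), less c0 n/4 for fluctuation, are below A + 1. As 1 < c0 n/4, this leaves c0 n/2 \<le> (1
        + c0) A \<le> 2 A.\<close>
      ultimately have "c0 / 4 * real n \<le> (\<Sum>k<n. ?N k)"
        by (simp add: right_diff_distrib)
      then show ?case unfolding f c0_def .
    qed
  qed
qed

definition mean :: real where "mean = \<mu> / (1 - \<alpha>)"

text \<open>Since \<open>mean\<close> is the fixed point of x -> \<alpha> x + \<mu>, the error sum
  telescopes to (1 - \<alpha>) times the centered sum plus X_n - X_0; the growth bound removes the
  boundary term after division by n.\<close>

lemma AE_X_mean: "AE \<omega> in M. (\<lambda>n. (\<Sum>k<n. real (X k \<omega>) - mean) / real n) \<longlonglongrightarrow> 0"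
  using AE_noise_averages(1) AE_X_growth
proof eventually_elim
  case (elim \<omega>)
  define x where "x k = real (X k \<omega>)" for k
  have "(\<lambda>n. x n / real n) \<longlonglongrightarrow> 0"
  proof (rule tendsto_sandwich[where f="\<lambda>_. 0" and h="\<lambda>n. (1 + real n) powr (3/4) / real n"])
    show "\<forall>\<^sub>F n in sequentially. x n / real n \<le> (1 + real n) powr (3/4) / real n"
      using elim(2) by eventually_elim (auto simp: x_def intro!: divide_right_mono)
    show "(\<lambda>n. (1 + real n) powr (3/4) / real n) \<longlonglongrightarrow> 0" by real_asymp
  qed (auto simp: x_def)
  then have "(\<lambda>n. ((\<Sum>k<n. x (Suc k) - \<alpha> * x k - \<mu>) / real n - x n / real n + x 0 / real n) / (1 - \<alpha>)) \<longlonglongrightarrow> (0 - 0 + 0) / (1 - \<alpha>)"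
    using elim(1)[folded x_def] \<alpha> by (intro tendsto_intros lim_const_over_n) auto
  moreover have "((\<Sum>k<n. x (Suc k) - \<alpha> * x k - \<mu>) / real n - x n / real n + x 0 / real n) / (1 - \<alpha>)
      = (\<Sum>k<n. x k - mean) / real n" for n
  proof -
    have "(\<Sum>k<n. x (Suc k) - \<alpha> * x k - \<mu>) = (1 - \<alpha>) * (\<Sum>k<n. x k - mean) + x n - x 0"
    proof (induction n)
      case (Suc n)
      have "\<mu> = (1 - \<alpha>) * mean" unfolding mean_def using \<alpha> by simp
      then show ?case using Suc by (simp add: algebra_simps)
    qed simp
    then show ?thesis using \<alpha> by (simp add: add_divide_distrib diff_divide_distrib)
  qed
  ultimately show ?case by (simp add: x_def)
qed

lemma AE_X_variance:
  obtains d where "0 < d" "d \<le> 1"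
    "AE \<omega> in M. \<forall>\<^sub>F n in sequentially. d * real n \<le> (\<Sum>k<n. (real (X k \<omega>) - mean)\<^sup>2)"
proof (cases "\<exists>x::nat. mean = real x")
  case True
  then obtain x :: nat where x: "mean = real x" by blast
  \<comment> \<open>Positivity excludes the state 0, in which there is no Bernoulli variable to move
    the chain.\<close>
  have "0 < mean" unfolding mean_def using \<mu>_pos \<alpha> by simp
  with x have "1 \<le> x" by simp
  from AE_leaves_state[OF this]
  have "AE \<omega> in M. \<forall>\<^sub>F n in sequentially. min \<alpha> (1 - \<alpha>) / 4 * real n \<le> (\<Sum>k<n. (real (X k \<omega>) - mean)\<^sup>2)"
  proof eventually_elim
    case (elim \<omega>)
    then show ?case
    proof eventually_elim
      case (elim n)
      have "real (card {k. k < n \<and> X k \<omega> \<noteq> x}) = (\<Sum>k\<in>{k. k < n \<and> X k \<omega> \<noteq> x}. 1)" by simp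
      also have "\<dots> \<le> (\<Sum>k\<in>{k. k < n \<and> X k \<omega> \<noteq> x}. (real (X k \<omega>) - mean)\<^sup>2)"
      proof (rule sum_mono)
        fix k assume "k \<in> {k. k < n \<and> X k \<omega> \<noteq> x}"
        then have "1 \<le> \<bar>real (X k \<omega>) - mean\<bar>" unfolding x by auto
        then show "1 \<le> (real (X k \<omega>) - mean)\<^sup>2" by (metis one_le_power power2_abs)
      qed
      also have "\<dots> \<le> (\<Sum>k<n. (real (X k \<omega>) - mean)\<^sup>2)" by (intro sum_mono2) auto
      finally show ?case using elim by linarith
    qed
  qed
  then show thesis using \<alpha> by (intro that[of "min \<alpha> (1 - \<alpha>) / 4"]) auto
next
  case False
  \<comment> \<open>The distance from the mean to the nearest integer, hence a uniform lower bound
    for every deviation of the chain.\<close>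
  define \<delta> where "\<delta> = min (frac mean) (1 - frac mean)"
  have "frac mean \<noteq> 0"
  proof
    assume "frac mean = 0"
    then have "mean = of_int \<lfloor>mean\<rfloor>" by (simp add: frac_def)
    moreover have "0 \<le> mean" unfolding mean_def using \<mu>_pos \<alpha> by simp
    ultimately have "mean = real (nat \<lfloor>mean\<rfloor>)" by simp
    with False show False by blast
  qed
  then have \<delta>: "0 < \<delta>" "\<delta> \<le> 1"
    unfolding \<delta>_def using frac_lt_1[of mean] frac_ge_0[of mean] by auto
  have "\<delta> \<le> \<bar>real n - mean\<bar>" for n
  proof (cases "int n \<le> \<lfloor>mean\<rfloor>")
    case True
    then have "real n \<le> of_int \<lfloor>mean\<rfloor>" by linarith
    then show ?thesis unfolding \<delta>_def frac_def by linarith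
  next
    case False
    then have "of_int \<lfloor>mean\<rfloor> + 1 \<le> real n" by linarith
    then show ?thesis unfolding \<delta>_def frac_def by linarith
  qed
  then have "\<delta>\<^sup>2 \<le> (real n - mean)\<^sup>2" for n
    using \<delta> by (metis less_imp_le power2_abs power_mono)
  then have "(\<Sum>k<n. \<delta>\<^sup>2) \<le> (\<Sum>k<n. (real (X k \<omega>) - mean)\<^sup>2)" for n \<omega>
    by (intro sum_mono)
  then have "AE \<omega> in M. \<forall>\<^sub>F n in sequentially. \<delta>\<^sup>2 * real n \<le> (\<Sum>k<n. (real (X k \<omega>) - mean)\<^sup>2)"
    by (simp add: mult.commute)
  moreover have "\<delta>\<^sup>2 \<le> 1" using \<delta> by (simp add: abs_square_le_1)
  ultimately show thesis using \<delta> by (intro that[of "\<delta>\<^sup>2"]) auto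
qed

end

theorem theorem3p7p1:
  fixes M :: "'a measure"
    and X0 :: "'a \<Rightarrow> nat" and eps :: "nat \<Rightarrow> 'a \<Rightarrow> nat" and xi :: "nat \<Rightarrow> nat \<Rightarrow> 'a \<Rightarrow> nat"
    and \<alpha> \<mu> :: real and s \<theta>1 \<theta>2 :: nat
  assumes "prob_space M"
    and "0 < \<alpha>" "\<alpha> < 1"
    and "s \<ge> 1" "\<theta>1 \<ge> 1" "\<theta>2 \<ge> 1"
    and "prob_space.indep_vars M (\<lambda>_. count_space UNIV) (inar_vars X0 eps xi) inar_index_set"
    and "\<And>k. k \<ge> 1 \<Longrightarrow> distr M (count_space UNIV) (eps k) = distr M (count_space UNIV) (eps 1)"
    and "integrable M (\<lambda>\<omega>. (real (eps 1 \<omega>))\<^sup>2)"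
    and "measure M {\<omega> \<in> space M. eps 1 \<omega> \<noteq> 0} > 0"
    and "\<And>k j. k \<ge> 1 \<Longrightarrow> j \<ge> 1 \<Longrightarrow>
           distr M (count_space UNIV) (xi k j) = measure_pmf (map_pmf of_bool (bernoulli_pmf \<alpha>))"
    and "integrable M (\<lambda>\<omega>. (real (X0 \<omega>))\<^sup>2)"
    and "\<mu> = integral\<^sup>L M (\<lambda>\<omega>. real (eps 1 \<omega>))"
  shows "(AE \<omega> in M. \<exists>n0. \<forall>n\<ge>n0. \<exists>!p. \<forall>q.
            Q2 s n (\<lambda>k. inar_Y X0 eps xi s \<theta>1 \<theta>2 k \<omega>) p \<le> Q2 s n (\<lambda>k. inar_Y X0 eps xi s \<theta>1 \<theta>2 k \<omega>) q)
       \<and> (AE \<omega> in M.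
            let Y = (\<lambda>k. inar_Y X0 eps xi s \<theta>1 \<theta>2 k \<omega>);
                est = (\<lambda>n. Q2_argmin s n Y);
                D = 1 + \<alpha>\<^sup>2 + \<alpha>^4
            in (\<lambda>n. fst (est n)) \<longlonglongrightarrow> \<alpha>
             \<and> (\<lambda>n. fst (snd (est n))) \<longlonglongrightarrow> \<mu>
             \<and> (\<lambda>n. fst (snd (snd (est n)))) \<longlonglongrightarrow>
                 Y s + (- \<alpha> * (1 + \<alpha>\<^sup>2) * Y (s - 1) - \<alpha>\<^sup>2 * Y (s + 2) - (1 - \<alpha>^3) * \<mu>) / D
             \<and> (\<lambda>n. snd (snd (snd (est n)))) \<longlonglongrightarrow>
                 Y (s + 1) + (- \<alpha>\<^sup>2 * Y (s - 1) - \<alpha> * (1 + \<alpha>\<^sup>2) * Y (s + 2) - (1 - \<alpha>^3) * \<mu>) / D)"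
proof -
  interpret prob_space M by fact
  interpret inar M X0 eps xi \<alpha> \<mu>
    by unfold_locales (rule assms; assumption)+
  let ?Y = "\<lambda>\<omega> k. inar_Y X0 eps xi s \<theta>1 \<theta>2 k \<omega>"
  obtain d where d: "0 < d" "d \<le> 1"
    "AE \<omega> in M. \<forall>\<^sub>F n in sequentially. d * real n \<le> (\<Sum>k<n. (real (X k \<omega>) - mean)\<^sup>2)"
    by (rule AE_X_variance)
  \<comment> \<open>One null set serves both conclusions: outside it the path meets all the
    hypotheses of the deterministic part, with \<open>mean\<close> as centering constant.\<close>
  have sample: "AE \<omega> in M. outlier_sample (\<lambda>k. real (X k \<omega>)) (?Y \<omega>) \<alpha> \<mu> mean d s"
    using AE_noise_averages AE_X_mean d(3)
  proof eventually_elim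
    case (elim \<omega>)
    then show ?case
      using d(1,2) \<open>s \<ge> 1\<close> by unfold_locales (auto simp: inar_Y_def)
  qed
  show ?thesis
  proof
    show "AE \<omega> in M. \<exists>n0. \<forall>n\<ge>n0. \<exists>!p. \<forall>q. Q2 s n (?Y \<omega>) p \<le> Q2 s n (?Y \<omega>) q"
      using sample by eventually_elim (rule outlier_sample.Q2_minimizer_consistent(1))
  next
    show "AE \<omega> in M.
            let Y = ?Y \<omega>; est = (\<lambda>n. Q2_argmin s n Y); D = 1 + \<alpha>\<^sup>2 + \<alpha>^4
            in (\<lambda>n. fst (est n)) \<longlonglongrightarrow> \<alpha>
             \<and> (\<lambda>n. fst (snd (est n))) \<longlonglongrightarrow> \<mu>
             \<and> (\<lambda>n. fst (snd (snd (est n)))) \<longlonglongrightarrow>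
                 Y s + (- \<alpha> * (1 + \<alpha>\<^sup>2) * Y (s - 1) - \<alpha>\<^sup>2 * Y (s + 2) - (1 - \<alpha>^3) * \<mu>) / D
             \<and> (\<lambda>n. snd (snd (snd (est n)))) \<longlonglongrightarrow>
                 Y (s + 1) + (- \<alpha>\<^sup>2 * Y (s - 1) - \<alpha> * (1 + \<alpha>\<^sup>2) * Y (s + 2) - (1 - \<alpha>^3) * \<mu>) / D"
      using sample
    proof eventually_elim
      case (elim \<omega>)
      note lim = outlier_sample.Q2_minimizer_consistent(2-5)[OF elim, unfolded profile_theta1_def profile_theta2_def prod.case]
      show ?case unfolding Let_def by (intro conjI lim)
    qed
  qed
qed

end
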